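(* Let $F$ be an algebraically closed field, $Q$ a finite acyclic quiver, and $\mu=\Theta/\kappa$ a slope function for $Q$. Let $\mathbf{d}$ be a dimension vector, $0<\delta<1$ and $\epsilon>0$. There exists a $(\delta,\epsilon)$-expander of dimension vector $\mathbf{d}$ (with respect to $\mu$) if and only if, for all $0\ne\mathbf{e}\hookrightarrow\mathbf{d}$ such that $\kappa(\mathbf{e})\le\delta\cdot\kappa(\mathbf{d})$, we have $\mu(\mathbf{e})\le\mu(\mathbf{d})-\epsilon$.
   Context: All representations are finite-dimensional representations of $Q$ over $F$. Dimension vectors are vectors $\mathbf{d}=\sum_{i\in Q_0}d_i\mathbf{i}$ with nonnegative integer entries, and $\mathbf{dim}(V)=\sum_i(\dim_FV_i)\mathbf{i}$. For dimension vectors, $\mathbf{e}\le\mathbf{d}$ is componentwise. For $\mathbf{e}\le\mathbf{d}$ we write $\mathbf{e}\hookrightarrow\mathbf{d}$ if every representation of $Q$ over $F$ of dimension vector $\mathbf{d}$ admits a subrepresentation of dimension vector $\mathbf{e}$. Slope function: $\Theta,\kappa\in(\mathbb{R}Q_0)^*$ are linear functionals with $\kappa(\mathbf{i})>0$ for all $i\in Q_0$, and $\mu(\mathbf{d})=\Theta(\mathbf{d})/\kappa(\mathbf{d})$ for $\mathbf{d}\in\mathbb{R}_{\ge0}Q_0\setminus\{0\}$; $\kappa(V),\mu(V)$ denote the values at $\mathbf{dim}(V)$. A representation $V$ is a $(\delta,\epsilon)$-expander (with respect to $\mu$) if for all nonzero subrepresentations $U\subset V$ with $\kappa(U)\le\delta\cdot\kappa(V)$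 we have $\mu(U)\le\mu(V)-\epsilon$. *)

theory Defs
  imports
    Complex_Main
    "HOL-Library.Function_Algebras"
    "HOL-Computational_Algebra.Polynomial"
    "Graph_Theory.Arc_Walk"
begin

text \<open>
  A quiver is a directed multigraph (loops and parallel arrows allowed), that is a
  \<^locale>\<open>fin_digraph\<close>. \<^const>\<open>pre_digraph.cycle\<close> counts loops as cycles.
\<close>

definition acyclic_quiver :: "('v, 'a) pre_digraph \<Rightarrow> bool" where
  "acyclic_quiver Q \<longleftrightarrow> fin_digraph Q \<and> (\<nexists>p. pre_digraph.cycle Q p)"

text \<open>
  Integer vectors indexed by the vertices are functions on the whole type \<open>'v\<close> that vanish
  outside \<^term>\<open>verts Q\<close>; the order \<open>\<le>\<close> and the zero vector are then the pointwise ones.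
\<close>

definition dimension_vector :: "('v, 'a) pre_digraph \<Rightarrow> ('v \<Rightarrow> nat) \<Rightarrow> bool" where
  "dimension_vector Q d \<longleftrightarrow> (\<forall>i. i \<notin> verts Q \<longrightarrow> d i = 0)"

text \<open>The linear functional whose value at the basis vector of the vertex \<open>i\<close> is \<open>\<theta> i\<close>.\<close>

definition functional :: "('v, 'a) pre_digraph \<Rightarrow> ('v \<Rightarrow> real) \<Rightarrow> ('v \<Rightarrow> nat) \<Rightarrow> real" where
  "functional Q \<theta> d = (\<Sum>i\<in>verts Q. \<theta> i * real (d i))"

definition slope ::
  "('v, 'a) pre_digraph \<Rightarrow> ('v \<Rightarrow> real) \<Rightarrow> ('v \<Rightarrow> real) \<Rightarrow> ('v \<Rightarrow> nat) \<Rightarrow> real" where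
  "slope Q \<Theta> \<kappa> d = functional Q \<Theta> d / functional Q \<kappa> d"

definition linear_on ::
  "('f::field \<Rightarrow> 'w::ab_group_add \<Rightarrow> 'w) \<Rightarrow> 'w set \<Rightarrow> ('w \<Rightarrow> 'w) \<Rightarrow> bool" where
  "linear_on scale S f \<longleftrightarrow>
     (\<forall>x\<in>S. \<forall>y\<in>S. f (x + y) = f x + f y) \<and> (\<forall>c. \<forall>x\<in>S. f (scale c x) = scale c (f x))"

text \<open>
  The spaces of a representation are finite-dimensional subspaces of one ambient vector space
  \<open>'w\<close> with scalar multiplication \<open>scale\<close>. Values of \<^term>\<open>rep_space V\<close> outside \<^term>\<open>verts Q\<close>, of
  \<^term>\<open>rep_map V\<close> outside \<^term>\<open>arcs Q\<close>, and of an arrow map outside the space at its tail are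
  irrelevant.
\<close>

record ('v, 'a, 'w) quiver_rep =
  rep_space :: "'v \<Rightarrow> 'w set"
  rep_map :: "'a \<Rightarrow> 'w \<Rightarrow> 'w"

definition quiver_representation ::
  "('f::field \<Rightarrow> 'w::ab_group_add \<Rightarrow> 'w) \<Rightarrow> ('v, 'a) pre_digraph \<Rightarrow> ('v, 'a, 'w) quiver_rep \<Rightarrow> bool"
where
  "quiver_representation scale Q V \<longleftrightarrow>
     (\<forall>i\<in>verts Q. module.subspace scale (rep_space V i) \<and>
        (\<exists>B. finite B \<and> rep_space V i \<subseteq> module.span scale B)) \<and>
     (\<forall>a\<in>arcs Q. linear_on scale (rep_space V (tail Q a)) (rep_map V a) \<and>
        rep_map V a ` rep_space V (tail Q a) \<subseteq> rep_space V (head Q a))"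

definition subrepresentation ::
  "('f::field \<Rightarrow> 'w::ab_group_add \<Rightarrow> 'w) \<Rightarrow> ('v, 'a) pre_digraph \<Rightarrow> ('v, 'a, 'w) quiver_rep \<Rightarrow>
   ('v \<Rightarrow> 'w set) \<Rightarrow> bool"
where
  "subrepresentation scale Q V U \<longleftrightarrow>
     (\<forall>i\<in>verts Q. module.subspace scale (U i) \<and> U i \<subseteq> rep_space V i) \<and>
     (\<forall>a\<in>arcs Q. rep_map V a ` U (tail Q a) \<subseteq> U (head Q a))"

definition dimvec ::
  "('f::field \<Rightarrow> 'w::ab_group_add \<Rightarrow> 'w) \<Rightarrow> ('v, 'a) pre_digraph \<Rightarrow> ('v \<Rightarrow> 'w set) \<Rightarrow> 'v \<Rightarrow> nat"
where
  "dimvec scale Q U = (\<lambda>i. if i \<in> verts Q then vector_space.dim scale (U i) else 0)"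

definition expander ::
  "('f::field \<Rightarrow> 'w::ab_group_add \<Rightarrow> 'w) \<Rightarrow> ('v, 'a) pre_digraph \<Rightarrow> ('v \<Rightarrow> real) \<Rightarrow> ('v \<Rightarrow> real) \<Rightarrow>
   real \<Rightarrow> real \<Rightarrow> ('v, 'a, 'w) quiver_rep \<Rightarrow> bool"
where
  "expander scale Q \<Theta> \<kappa> \<delta> \<epsilon> V \<longleftrightarrow>
     quiver_representation scale Q V \<and>
     (\<forall>U. subrepresentation scale Q V U \<and> (\<exists>i\<in>verts Q. U i \<noteq> {0}) \<and>
        functional Q \<kappa> (dimvec scale Q U) \<le> \<delta> * functional Q \<kappa> (dimvec scale Q (rep_space V)) \<longrightarrow>
        slope Q \<Theta> \<kappa> (dimvec scale Q U) \<le> slope Q \<Theta> \<kappa> (dimvec scale Q (rep_space V)) - \<epsilon>)"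

text \<open>
  Quantification over all representations over \<open>'f\<close> is over those whose spaces are
  finite-dimensional subspaces of the infinite-dimensional space \<^typ>\<open>nat \<Rightarrow> 'f\<close>. Every representation
  in any other ambient space is isomorphic to one of these, so nothing is lost; see the lemmas
  \<open>embeds_any_space\<close> and \<open>expander_any_space\<close> below.
\<close>

definition seq_scale :: "'f::field \<Rightarrow> (nat \<Rightarrow> 'f) \<Rightarrow> (nat \<Rightarrow> 'f)" where
  "seq_scale c v = (\<lambda>n. c * v n)"

text \<open>The relation \<open>\<^bold>e \<hookrightarrow> \<^bold>d\<close>.\<close>

definition embeds ::
  "'f::field itself \<Rightarrow> ('v, 'a) pre_digraph \<Rightarrow> ('v \<Rightarrow> nat) \<Rightarrow> ('v \<Rightarrow> nat) \<Rightarrow> bool" where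
  "embeds F Q e d \<longleftrightarrow> e \<le> d \<and>
     (\<forall>V :: ('v, 'a, nat \<Rightarrow> 'f) quiver_rep.
        quiver_representation seq_scale Q V \<and> dimvec seq_scale Q (rep_space V) = d \<longrightarrow>
        (\<exists>U. subrepresentation seq_scale Q V U \<and> dimvec seq_scale Q U = e))"

lemma vector_space_seq_scale: "vector_space (seq_scale :: 'f::field \<Rightarrow> _)"
  by unfold_locales (auto simp: seq_scale_def fun_eq_iff algebra_simps)

lemma independent_seq_unit:
  fixes D :: "nat set"
  assumes "finite D"
  defines "u \<equiv> (\<lambda>k n. if n = k then 1 else 0 :: 'f::field)"
  shows "\<not> module.dependent seq_scale (u ` D)" and "card (u ` D) = card D"
proof -
  interpret vector_space "seq_scale :: 'f \<Rightarrow> _" by (rule vector_space_seq_scale)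
  have inj: "inj_on u A" for A
    by (rule inj_onI) (metis u_def zero_neq_one)
  then show "card (u ` D) = card D" by (simp add: card_image)
  show "independent (u ` D)"
    unfolding independent_explicit_finite_subsets
  proof (intro allI impI ballI)
    fix A c v
    assume A: "A \<subseteq> u ` D" "finite A" "(\<Sum>v\<in>A. seq_scale (c v) v) = 0" and v: "v \<in> A"
    obtain B where B: "B \<subseteq> D" "A = u ` B" using A(1) by (meson subset_imageE)
    obtain k where k: "k \<in> B" "v = u k" using v B by auto
    have fB: "finite B" using B(1) assms(1) finite_subset by blast
    have pt: "(\<Sum>j\<in>X. f j) n = (\<Sum>j\<in>X. f j n)" for X :: "nat set" and f :: "nat \<Rightarrow> nat \<Rightarrow> 'f" and n
      by (induction X rule: infinite_finite_induct) auto
    have "0 = (\<Sum>j\<in>B. seq_scale (c (u j)) (u j)) k"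
      using A(3) by (simp add: B(2) sum.reindex[OF inj])
    also have "\<dots> = (\<Sum>j\<in>B. if j = k then c (u j) else 0)"
      unfolding pt by (intro sum.cong) (auto simp: seq_scale_def u_def)
    also have "\<dots> = c v" using fB k by simp
    finally show "c v = 0" by simp
  qed
qed

lemma dim_linear_image:
  fixes s1 :: "'f::field \<Rightarrow> 'w::ab_group_add \<Rightarrow> 'w" and s2 :: "'f \<Rightarrow> 'u::ab_group_add \<Rightarrow> 'u"
  assumes "Vector_Spaces.linear s1 s2 f" "module.subspace s1 S" "inj_on f S"
  shows "vector_space.dim s2 (f ` S) = vector_space.dim s1 S"
proof -
  interpret f: Vector_Spaces.linear s1 s2 f by fact
  obtain B where B: "B \<subseteq> S" "f.vs1.independent B" "S \<subseteq> f.vs1.span B" "card B = f.vs1.dim S"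
    using f.vs1.basis_exists by blast
  have S: "f.vs1.span B = S"
    using B(1,3) assms(2) by (metis f.vs1.span_subspace)
  have "f.vs2.independent (f ` B)"
    using B(2) assms(3) S by (intro f.independent_injective_image) auto
  moreover have "f.vs2.span (f ` B) = f ` S" using S by (simp add: f.span_image)
  moreover have "card (f ` B) = card B" using B(1) assms(3) by (meson card_image inj_on_subset)
  ultimately show ?thesis
    using B(4) by (metis f.vs2.dim_eq_card_independent f.vs2.dim_span)
qed

definition rep_iso ::
  "('f::field \<Rightarrow> 'w::ab_group_add \<Rightarrow> 'w) \<Rightarrow> ('f \<Rightarrow> 'u::ab_group_add \<Rightarrow> 'u) \<Rightarrow> ('v, 'a) pre_digraph \<Rightarrow>
   ('v, 'a, 'w) quiver_rep \<Rightarrow> ('v, 'a, 'u) quiver_rep \<Rightarrow> ('v \<Rightarrow> 'w \<Rightarrow> 'u) \<Rightarrow> bool"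
where
  "rep_iso s1 s2 Q V W g \<longleftrightarrow>
     (\<forall>i\<in>verts Q. Vector_Spaces.linear s1 s2 (g i) \<and>
        inj_on (g i) (rep_space V i) \<and> g i ` rep_space V i = rep_space W i) \<and>
     (\<forall>a\<in>arcs Q. \<forall>x\<in>rep_space V (tail Q a).
        rep_map W a (g (tail Q a) x) = g (head Q a) (rep_map V a x))"

lemma push_subrepresentation:
  fixes s1 :: "'f::field \<Rightarrow> 'w::ab_group_add \<Rightarrow> 'w" and s2 :: "'f \<Rightarrow> 'u::ab_group_add \<Rightarrow> 'u"
    and V :: "('v, 'a, 'w) quiver_rep" and W :: "('v, 'a, 'u) quiver_rep"
  assumes Q: "wf_digraph Q" and iso: "rep_iso s1 s2 Q V W g"
    and U: "subrepresentation s1 Q V U"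
  shows "subrepresentation s2 Q W (\<lambda>i. g i ` U i)"
    and "dimvec s2 Q (\<lambda>i. g i ` U i) = dimvec s1 Q U"
proof -
  interpret wf_digraph Q by fact
  have g: "Vector_Spaces.linear s1 s2 (g i)" "inj_on (g i) (rep_space V i)"
    "g i ` rep_space V i = rep_space W i" if "i \<in> verts Q" for i
    using iso that by (auto simp: rep_iso_def)
  have comm: "rep_map W a (g (tail Q a) x) = g (head Q a) (rep_map V a x)"
    if "a \<in> arcs Q" "x \<in> rep_space V (tail Q a)" for a x
    using iso that by (auto simp: rep_iso_def)
  have sub: "module.subspace s1 (U i)" "U i \<subseteq> rep_space V i" if "i \<in> verts Q" for i
    using U that by (auto simp: subrepresentation_def)
  have "module.subspace s2 (g i ` U i)" if "i \<in> verts Q" for i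
  proof -
    interpret gi: Vector_Spaces.linear s1 s2 "g i" using g that by blast
    show ?thesis using sub(1)[OF that] by (rule gi.subspace_image)
  qed
  moreover have "g i ` U i \<subseteq> rep_space W i" if "i \<in> verts Q" for i
    using g(3)[OF that] sub(2)[OF that] by blast
  moreover have "rep_map W a ` g (tail Q a) ` U (tail Q a) \<subseteq> g (head Q a) ` U (head Q a)"
    if a: "a \<in> arcs Q" for a
  proof clarify
    fix x assume x: "x \<in> U (tail Q a)"
    then have "x \<in> rep_space V (tail Q a)" using sub(2)[of "tail Q a"] a by auto
    moreover have "rep_map V a x \<in> U (head Q a)"
      using U a x unfolding subrepresentation_def by blast
    ultimately show "rep_map W a (g (tail Q a) x) \<in> g (head Q a) ` U (head Q a)"
      using comm[OF a] by auto
  qed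
  ultimately show "subrepresentation s2 Q W (\<lambda>i. g i ` U i)"
    unfolding subrepresentation_def by simp
  have "vector_space.dim s2 (g i ` U i) = vector_space.dim s1 (U i)" if "i \<in> verts Q" for i
    using dim_linear_image[OF g(1)[OF that] sub(1)[OF that] inj_on_subset[OF g(2)[OF that] sub(2)[OF that]]] .
  then show "dimvec s2 Q (\<lambda>i. g i ` U i) = dimvec s1 Q U"
    by (auto simp: dimvec_def fun_eq_iff)
qed

lemma rep_iso_dimvec:
  fixes s1 :: "'f::field \<Rightarrow> 'w::ab_group_add \<Rightarrow> 'w" and s2 :: "'f \<Rightarrow> 'u::ab_group_add \<Rightarrow> 'u"
    and V :: "('v, 'a, 'w) quiver_rep" and W :: "('v, 'a, 'u) quiver_rep"
  assumes "wf_digraph Q" "quiver_representation s1 Q V" "rep_iso s1 s2 Q V W g"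
  shows "dimvec s2 Q (rep_space W) = dimvec s1 Q (rep_space V)"
proof -
  have "subrepresentation s1 Q V (rep_space V)"
    using assms(2) by (auto simp: quiver_representation_def subrepresentation_def)
  then have "dimvec s2 Q (\<lambda>i. g i ` rep_space V i) = dimvec s1 Q (rep_space V)"
    by (rule push_subrepresentation(2)[OF assms(1,3)])
  moreover have "dimvec s2 Q (\<lambda>i. g i ` rep_space V i) = dimvec s2 Q (rep_space W)"
    using assms(3) by (auto simp: dimvec_def rep_iso_def fun_eq_iff)
  ultimately show ?thesis by simp
qed

lemma exists_seq_coordinates:
  fixes s :: "'f::field \<Rightarrow> 'w::ab_group_add \<Rightarrow> 'w"
  assumes "vector_space s" "module.subspace s S" "finite B" "S \<subseteq> module.span s B"
  shows "\<exists>g h. Vector_Spaces.linear s seq_scale g \<and> Vector_Spaces.linear seq_scale s h \<and> (\<forall>x\<in>S. h (g x) = x)"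
proof -
  interpret vs: vector_space s by fact
  interpret seq: vector_space "seq_scale :: 'f \<Rightarrow> _" by (rule vector_space_seq_scale)
  interpret vector_space_pair s "seq_scale :: 'f \<Rightarrow> _" by unfold_locales
  obtain C where C: "C \<subseteq> S" "vs.independent C" "S \<subseteq> vs.span C" "card C = vs.dim S"
    using vs.basis_exists by blast
  have fC: "finite C"
    using vs.independent_span_bound[OF assms(3) C(2)] C(1) assms(4) by auto
  define u :: "nat \<Rightarrow> nat \<Rightarrow> 'f" where "u = (\<lambda>k n. if n = k then 1 else 0)"
  define D where "D = u ` {..<card C}"
  have D: "seq.independent D" "card D = card C" "finite D"
    using independent_seq_unit[of "{..<card C}", where 'f='f] by (auto simp: D_def u_def)
  have T: "seq.subspace (seq.span D)" "seq.dim (seq.span D) = card D"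
    using D(1) by (auto simp: seq.dim_eq_card_independent seq.subspace_span)
  obtain g where g: "Vector_Spaces.linear s seq_scale g" "inj_on g S"
    using finite_basis_to_basis_subspace_isomorphism[OF assms(2) T(1) _ fC C D(3) seq.span_superset D(1) subset_refl]
      T(2) D(2) C(4) by (metis)
  show ?thesis
    using linear_exists_left_inverse_on[OF g(1) assms(2) g(2)] g(1) by blast
qed

lemma representation_in_seq_space:
  fixes s :: "'f::field \<Rightarrow> 'w::ab_group_add \<Rightarrow> 'w" and V :: "('v, 'a, 'w) quiver_rep"
  assumes Q: "wf_digraph Q" and s: "vector_space s" and V: "quiver_representation s Q V"
  shows "\<exists>(W :: ('v, 'a, nat \<Rightarrow> 'f) quiver_rep) g h.
    quiver_representation seq_scale Q W \<and> rep_iso s seq_scale Q V W g \<and> rep_iso seq_scale s Q W V h"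
proof -
  interpret wf_digraph Q by fact
  have VS: "module.subspace s (rep_space V i)" "\<exists>B. finite B \<and> rep_space V i \<subseteq> module.span s B"
    if "i \<in> verts Q" for i
    using V that by (auto simp: quiver_representation_def)
  have "\<exists>g h. Vector_Spaces.linear s seq_scale g \<and> Vector_Spaces.linear seq_scale s h \<and>
      (\<forall>x\<in>rep_space V i. h (g x) = x)" if "i \<in> verts Q" for i
    using exists_seq_coordinates[OF s] VS[OF that] by blast
  then obtain g h where g: "\<And>i. i \<in> verts Q \<Longrightarrow> Vector_Spaces.linear s seq_scale (g i)"
    and h: "\<And>i. i \<in> verts Q \<Longrightarrow> Vector_Spaces.linear seq_scale s (h i)"
    and hg: "\<And>i x. i \<in> verts Q \<Longrightarrow> x \<in> rep_space V i \<Longrightarrow> h i (g i x) = x"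
    by metis
  define W where "W = \<lparr>rep_space = (\<lambda>i. g i ` rep_space V i),
    rep_map = (\<lambda>a. g (head Q a) \<circ> rep_map V a \<circ> h (tail Q a))\<rparr>"
  have WS: "rep_space W i = g i ` rep_space V i" for i by (simp add: W_def)
  have WM: "rep_map W a (g (tail Q a) x) = g (head Q a) (rep_map V a x)"
    if "a \<in> arcs Q" "x \<in> rep_space V (tail Q a)" for a x
    using that hg by (simp add: W_def)
  have VM: "rep_map V a x \<in> rep_space V (head Q a)"
    if "a \<in> arcs Q" "x \<in> rep_space V (tail Q a)" for a x
    using V that unfolding quiver_representation_def by blast
  have "module.subspace seq_scale (rep_space W i) \<and>
      (\<exists>B. finite B \<and> rep_space W i \<subseteq> module.span seq_scale B)" if i: "i \<in> verts Q" for i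
  proof -
    interpret gi: Vector_Spaces.linear s seq_scale "g i" using g i by blast
    obtain B where B: "finite B" "rep_space V i \<subseteq> gi.vs1.span B" using VS(2)[OF i] by blast
    have "rep_space W i \<subseteq> gi.vs2.span (g i ` B)"
      using B(2) by (auto simp: WS gi.span_image)
    moreover have "gi.vs2.subspace (rep_space W i)"
      using gi.subspace_image[OF VS(1)[OF i]] by (simp add: WS)
    ultimately show ?thesis using B(1) by blast
  qed
  moreover have "linear_on seq_scale (rep_space W (tail Q a)) (rep_map W a)" if a: "a \<in> arcs Q" for a
  proof -
    interpret t: Vector_Spaces.linear s seq_scale "g (tail Q a)" using g a by auto
    interpret hd: Vector_Spaces.linear s seq_scale "g (head Q a)" using g a by auto
    have lin: "linear_on s (rep_space V (tail Q a)) (rep_map V a)"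
      using V a by (auto simp: quiver_representation_def)
    have S: "t.vs1.subspace (rep_space V (tail Q a))" using VS(1) a by auto
    have "rep_map W a (g (tail Q a) x + g (tail Q a) y) =
        rep_map W a (g (tail Q a) x) + rep_map W a (g (tail Q a) y)"
      if "x \<in> rep_space V (tail Q a)" "y \<in> rep_space V (tail Q a)" for x y
      using lin that a WM t.vs1.subspace_add[OF S that]
      by (simp add: linear_on_def hd.add flip: t.add)
    moreover have "rep_map W a (seq_scale c (g (tail Q a) x)) = seq_scale c (rep_map W a (g (tail Q a) x))"
      if "x \<in> rep_space V (tail Q a)" for c x
      using lin that a WM t.vs1.subspace_scale[OF S that]
      by (simp add: linear_on_def hd.scale flip: t.scale)
    ultimately show ?thesis by (auto simp: linear_on_def WS)
  qed
  moreover have "rep_map W a ` rep_space W (tail Q a) \<subseteq> rep_space W (head Q a)"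
    if "a \<in> arcs Q" for a
    using that VM WM by (auto simp: WS)
  ultimately have "quiver_representation seq_scale Q W"
    by (simp add: quiver_representation_def)
  moreover have "rep_iso s seq_scale Q V W g"
    using g hg WM unfolding rep_iso_def WS by (metis inj_on_inverseI)
  moreover have "rep_iso seq_scale s Q W V h"
    unfolding rep_iso_def
  proof (intro conjI ballI)
    fix i assume i: "i \<in> verts Q"
    show "Vector_Spaces.linear seq_scale s (h i)" using h i .
    show "inj_on (h i) (rep_space W i)" using hg[OF i] by (auto simp: inj_on_def WS)
    show "h i ` rep_space W i = rep_space V i" using hg[OF i] by (force simp: WS)
  next
    fix a x assume a: "a \<in> arcs Q" and "x \<in> rep_space W (tail Q a)"
    then obtain y where y: "y \<in> rep_space V (tail Q a)" "x = g (tail Q a) y" by (auto simp: WS)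
    show "rep_map V a (h (tail Q a) x) = h (head Q a) (rep_map W a x)"
      using a y hg VM WM by simp
  qed
  ultimately show ?thesis by blast
qed

lemma embeds_any_space:
  fixes s :: "'f::field \<Rightarrow> 'w::ab_group_add \<Rightarrow> 'w" and V :: "('v, 'a, 'w) quiver_rep"
  assumes Q: "wf_digraph Q" and e: "embeds TYPE('f) Q e d"
    and s: "vector_space s" and V: "quiver_representation s Q V" "dimvec s Q (rep_space V) = d"
  shows "\<exists>U. subrepresentation s Q V U \<and> dimvec s Q U = e"
proof -
  obtain W :: "('v, 'a, nat \<Rightarrow> 'f) quiver_rep" and g h where W: "quiver_representation seq_scale Q W"
    and g: "rep_iso s seq_scale Q V W g" and h: "rep_iso seq_scale s Q W V h"
    using representation_in_seq_space[OF Q s V(1)] by blast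
  have "dimvec seq_scale Q (rep_space W) = d"
    using rep_iso_dimvec[OF Q V(1) g] V(2) by simp
  then obtain U where U: "subrepresentation seq_scale Q W U" "dimvec seq_scale Q U = e"
    using e W unfolding embeds_def by blast
  show ?thesis
    using push_subrepresentation[OF Q h U(1)] U(2) by blast
qed

lemma expander_any_space:
  fixes s :: "'f::field \<Rightarrow> 'w::ab_group_add \<Rightarrow> 'w" and V :: "('v, 'a, 'w) quiver_rep"
  assumes Q: "wf_digraph Q" and s: "vector_space s" and V: "expander s Q \<Theta> \<kappa> \<delta> \<epsilon> V"
  shows "\<exists>W :: ('v, 'a, nat \<Rightarrow> 'f) quiver_rep.
    expander seq_scale Q \<Theta> \<kappa> \<delta> \<epsilon> W \<and> dimvec seq_scale Q (rep_space W) = dimvec s Q (rep_space V)"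
proof -
  have V': "quiver_representation s Q V" using V by (simp add: expander_def)
  obtain W :: "('v, 'a, nat \<Rightarrow> 'f) quiver_rep" and g h where W: "quiver_representation seq_scale Q W"
    and g: "rep_iso s seq_scale Q V W g" and h: "rep_iso seq_scale s Q W V h"
    using representation_in_seq_space[OF Q s V'] by blast
  have d: "dimvec seq_scale Q (rep_space W) = dimvec s Q (rep_space V)"
    by (rule rep_iso_dimvec[OF Q V' g])
  have "slope Q \<Theta> \<kappa> (dimvec seq_scale Q U) \<le> slope Q \<Theta> \<kappa> (dimvec s Q (rep_space V)) - \<epsilon>"
    if U: "subrepresentation seq_scale Q W U" "i \<in> verts Q" "U i \<noteq> {0}"
      "functional Q \<kappa> (dimvec seq_scale Q U) \<le> \<delta> * functional Q \<kappa> (dimvec s Q (rep_space V))"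
    for U i
  proof -
    interpret hi: Vector_Spaces.linear seq_scale s "h i" using h U(2) by (simp add: rep_iso_def)
    have sub: "hi.vs1.subspace (U i)" "U i \<subseteq> rep_space W i"
      using U by (auto simp: subrepresentation_def)
    have "0 \<in> U i" by (rule hi.vs1.subspace_0[OF sub(1)])
    then obtain x where x: "x \<in> U i" "x \<noteq> 0" using U(3) by blast
    have "inj_on (h i) (rep_space W i)" using h U(2) by (simp add: rep_iso_def)
    then have "h i x \<noteq> 0" using x sub(2) \<open>0 \<in> U i\<close> hi.zero by (metis inj_on_def subsetD)
    then have "h i ` U i \<noteq> {0}" using x(1) by blast
    moreover have "functional Q \<kappa> (dimvec s Q (\<lambda>i. h i ` U i)) \<le> \<delta> * functional Q \<kappa> (dimvec s Q (rep_space V))"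
      using U(4) push_subrepresentation(2)[OF Q h U(1)] by simp
    ultimately have "slope Q \<Theta> \<kappa> (dimvec s Q (\<lambda>i. h i ` U i)) \<le> slope Q \<Theta> \<kappa> (dimvec s Q (rep_space V)) - \<epsilon>"
      using V push_subrepresentation(1)[OF Q h U(1)] U(2) unfolding expander_def by blast
    then show ?thesis using push_subrepresentation(2)[OF Q h U(1)] by simp
  qed
  then have "expander seq_scale Q \<Theta> \<kappa> \<delta> \<epsilon> W" using W unfolding expander_def d by blast
  then show ?thesis using d by blast
qed

end

theory Submission
  imports Defs "HOL-Library.Indicator_Function"
begin

text \<open>
  If some \<open>V\<close> is an expander and \<open>e \<hookrightarrow> d\<close>, then \<open>V\<close> has a subrepresentation of dimension
  vector \<open>e\<close>, and the expander inequality for it is the inequality for \<open>e\<close>. Conversely it is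
  enough to find one representation of dimension vector \<open>d\<close> all of whose subrepresentations have
  dimension vectors \<open>e \<hookrightarrow> d\<close> (\<open>general_representation_exists\<close>). Each of the finitely many
  \<open>e \<le> d\<close> with \<open>\<not> e \<hookrightarrow> d\<close> is avoided by some representation, and one has to avoid all of
  them at once. Geometrically, admitting a subrepresentation of dimension vector \<open>e\<close> is a Zariski
  closed condition, because quiver Grassmannians are projective, and the affine space of
  representations is irreducible.

  For this argument lines suffice. Join a representation that avoids finitely many dimension
  vectors to one that avoids one more (\<open>matrix_rep_avoiding\<close>): if each bad dimension vector
  excludes only finitely many points of the line, some point of it is good, since an algebraically
  closed field is infinite. So what is needed is closedness along a curve
  (\<open>has_subrep_specialization\<close>): if \<open>V s\<close> depends polynomially on \<open>s\<close> and has a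
  subrepresentation of dimension vector \<open>e\<close> for infinitely many \<open>s\<close>, it has one for every
  \<open>s\<^sub>0\<close>.

  To prove closedness one takes a limit of the given subrepresentations as \<open>s\<close> tends to
  \<open>s\<^sub>0\<close>. The field carries no topology, so limits are created algebraically: a limit
  assignment is a subalgebra \<open>L\<close> of the product of the algebra of all functions with the field,
  a pair \<open>(x, y) \<in> L\<close> meaning that \<open>x\<close> tends to \<open>y\<close>. Start with the pairs
  \<open>(p, p(s\<^sub>0))\<close> for polynomials \<open>p\<close> and take a maximal such \<open>L\<close> by Zorn's lemma.
  Maximality has two effects. The sets whose indicator tends to \<open>1\<close> form an ultrafilter; and every
  function either has a limit or has an inverse that tends to \<open>0\<close>
  (\<open>ultralimit_extension\<close>). Modulo the ultrafilter the functions form an ultrapower of the field,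
  and this is Chevalley's theorem that a homomorphism into an algebraically closed field extends to
  a place.

  The dichotomy is a compactness property. Gaussian elimination, with the dominant coordinate as
  the pivot at each step, gives the subspaces of a family in coordinate space bases in which every
  entry has a limit and the pivot block is the identity matrix (\<open>convergent_pivot_basis\<close>). The
  identity block survives in the limit, so the dimension does not drop, and the equations that say
  that the arrows preserve the subspaces pass to the limit as well.
\<close>

section \<open>Polynomials over function rings and over algebraically closed fields\<close>

lemma fun_power_apply: "((x :: 'i \<Rightarrow> 'f::comm_ring_1) ^ n) i = x i ^ n"
  by (induction n) auto

lemma fun_of_bool_apply: "(of_bool P :: 'i \<Rightarrow> 'f::comm_ring_1) i = of_bool P"
  by (cases P) auto

lemma fun_sum_apply: "(\<Sum>j\<in>A. f j) i = (\<Sum>j\<in>A. (f j :: 'i \<Rightarrow> 'f::comm_monoid_add) i)"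
  by (induction A rule: infinite_finite_induct) auto

lemma fun_poly_apply:
  "poly p x i = (\<Sum>k\<le>degree p. coeff p k i * (x :: 'i \<Rightarrow> 'f::comm_ring_1) i ^ k)"
  by (simp add: poly_altdef fun_sum_apply fun_power_apply)

lemma fun_poly_apply_cong:
  "x i = y i \<Longrightarrow> poly p (x :: 'i \<Rightarrow> 'f::comm_ring_1) i = poly p y i"
  by (simp add: fun_poly_apply)

lemma fun_poly_apply_zero:
  "x i = 0 \<Longrightarrow> poly p (x :: 'i \<Rightarrow> 'f::comm_ring_1) i = coeff p 0 i"
  by (cases p) simp

text \<open>
  The weak Nullstellensatz in one variable: an element of least degree generates the ideal, and it
  must be constant, since otherwise its root would be a common root.
\<close>

lemma poly_ideal_without_common_root:
  fixes J :: "'f::alg_closed_field poly set"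
  assumes add: "\<And>p q. p \<in> J \<Longrightarrow> q \<in> J \<Longrightarrow> p + q \<in> J"
    and smult: "\<And>c p. p \<in> J \<Longrightarrow> smult c p \<in> J"
    and shift: "\<And>p. p \<in> J \<Longrightarrow> pCons 0 p \<in> J"
    and root: "\<And>z. \<exists>p\<in>J. poly p z \<noteq> 0"
  shows "1 \<in> J"
proof -
  have mult: "r * p \<in> J" if "p \<in> J" for p r
  proof (induction r)
    case 0
    show ?case using smult[OF that, of 0] by simp
  next
    case (pCons a r)
    then show ?case by (simp add: add smult shift that mult_pCons_left)
  qed
  have "\<exists>p. p \<in> J \<and> p \<noteq> 0" using root[of 0] by force
  then obtain g where g: "g \<in> J" "g \<noteq> 0"
    and min: "\<And>p. p \<in> J \<Longrightarrow> p \<noteq> 0 \<Longrightarrow> degree g \<le> degree p"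
    using ex_has_least_nat[of "\<lambda>p. p \<in> J \<and> p \<noteq> 0" _ degree] by blast
  have dvd: "g dvd p" if "p \<in> J" for p
  proof (rule ccontr)
    assume "\<not> g dvd p"
    then have nz: "p mod g \<noteq> 0" by (simp add: dvd_eq_mod_eq_0)
    have "p mod g = p + (- (p div g)) * g" by (simp add: minus_div_mult_eq_mod [symmetric])
    also have "\<dots> \<in> J" using add[OF that mult[OF g(1)]] .
    finally have "degree g \<le> degree (p mod g)" using min nz by blast
    then show False using degree_mod_less[OF g(2), of p] nz by simp
  qed
  have "degree g = 0"
  proof (rule ccontr)
    assume "degree g \<noteq> 0"
    then obtain z where "poly g z = 0" using alg_closed_imp_poly_has_root by blast
    then have "poly p z = 0" if "p \<in> J" for p
      using dvd[OF that] by (metis dvdE mult_zero_left poly_mult)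
    then show False using root[of z] by blast
  qed
  then obtain c where c: "g = [:c:]" by (rule degree_eq_zeroE)
  then have "smult (inverse c) g = 1" using g(2) by (simp add: one_pCons)
  then show ?thesis using smult[OF g(1), of "inverse c"] by simp
qed

text \<open>Over a finite field, \<open>1 + (\<Prod>a. X - a)\<close> would have no root.\<close>

lemma infinite_UNIV_alg_closed_field: "infinite (UNIV :: 'f::alg_closed_field set)"
proof
  assume fin: "finite (UNIV :: 'f set)"
  define p :: "'f poly" where "p = (\<Prod>a\<in>UNIV. [:- a, 1:])"
  have deg: "degree p = card (UNIV :: 'f set)"
    unfolding p_def by (subst degree_prod_eq_sum_degree) auto
  moreover have "card (UNIV :: 'f set) > 0" using fin by (simp add: card_gt_0_iff)
  ultimately have "degree (p + 1) > 0"
    by (metis degree_1 degree_add_eq_left)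
  then obtain z where "poly (p + 1) z = 0" using alg_closed_imp_poly_has_root by blast
  moreover have "poly p z = 0" using fin by (auto simp: p_def poly_prod)
  ultimately show False by simp
qed

section \<open>Algebras of limits\<close>

text \<open>
  A pair \<open>(x, y) \<in> L\<close> says that the function \<open>x\<close> has the limit \<open>y\<close>. The last assumption makes
  \<open>L\<close> single-valued: the limit of a function depends only on its germ along the filter \<open>B\<close>.
\<close>

locale limit_algebra =
  fixes B :: "'i filter" and L :: "(('i \<Rightarrow> 'f::field) \<times> 'f) set"
  assumes const: "(\<lambda>_. c, c) \<in> L"
    and add: "(x, y) \<in> L \<Longrightarrow> (x', y') \<in> L \<Longrightarrow> (x + x', y + y') \<in> L"
    and mult: "(x, y) \<in> L \<Longrightarrow> (x', y') \<in> L \<Longrightarrow> (x * x', y * y') \<in> L"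
    and eventually_zero: "(x, y) \<in> L \<Longrightarrow> \<forall>\<^sub>F i in B. x i = 0 \<Longrightarrow> y = 0"
begin

lemma diff: "(x, y) \<in> L \<Longrightarrow> (x', y') \<in> L \<Longrightarrow> (x - x', y - y') \<in> L"
proof -
  assume x: "(x, y) \<in> L" and "(x', y') \<in> L"
  then have "((\<lambda>_. -1) * x', -1 * y') \<in> L" by (intro mult const)
  from add[OF x this] show ?thesis
    by (simp add: fun_eq_iff fun_diff_def plus_fun_def times_fun_def)
qed

lemma unique: "(x, y) \<in> L \<Longrightarrow> (x', y') \<in> L \<Longrightarrow> \<forall>\<^sub>F i in B. x i = x' i \<Longrightarrow> y = y'"
  using eventually_zero[OF diff, of x y x' y'] by simp

lemma sum:
  "finite A \<Longrightarrow> (\<And>j. j \<in> A \<Longrightarrow> (x j, y j) \<in> L) \<Longrightarrow> (\<Sum>j\<in>A. x j, \<Sum>j\<in>A. y j) \<in> L"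
proof (induction A rule: finite_induct)
  case empty
  then show ?case using const[of 0] by (simp add: zero_fun_def)
qed (simp add: add)

lemma power: "(x, y) \<in> L \<Longrightarrow> (x ^ n, y ^ n) \<in> L"
proof (induction n)
  case 0
  then show ?case using const[of 1] by (simp add: one_fun_def)
qed (simp add: mult)

text \<open>Coefficientwise limits; they describe the subalgebra generated by \<open>L\<close> and one more pair.\<close>

definition poly_lim :: "('i \<Rightarrow> 'f) poly \<Rightarrow> 'f poly \<Rightarrow> bool" where
  "poly_lim p q \<longleftrightarrow> (\<forall>k. (coeff p k, coeff q k) \<in> L)"

lemma poly_lim_add: "poly_lim p q \<Longrightarrow> poly_lim p' q' \<Longrightarrow> poly_lim (p + p') (q + q')"
  by (simp add: poly_lim_def add)

lemma poly_lim_mult: "poly_lim p q \<Longrightarrow> poly_lim p' q' \<Longrightarrow> poly_lim (p * p') (q * q')"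
  unfolding poly_lim_def coeff_mult by (intro allI sum mult) auto

lemma poly_lim_const: "(x, y) \<in> L \<Longrightarrow> poly_lim [:x:] [:y:]"
  using const[of 0] by (auto simp: poly_lim_def coeff_pCons zero_fun_def split: nat.splits)

lemma poly_lim_var: "poly_lim [:0, 1:] [:0, 1:]"
  using const[of 0] const[of 1]
  by (auto simp: poly_lim_def coeff_pCons zero_fun_def one_fun_def split: nat.splits)

lemma poly_lim_1D: "poly_lim p 1 \<Longrightarrow> (coeff p 0, 1) \<in> L"
  unfolding poly_lim_def by (auto dest: spec[of _ 0])

lemma poly_lim_eval: "poly_lim p q \<Longrightarrow> (x, y) \<in> L \<Longrightarrow> (poly p x, poly q y) \<in> L"
proof -
  assume p: "poly_lim p q" and x: "(x, y) \<in> L"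
  define n where "n = max (degree p) (degree q)"
  have "(\<Sum>k\<le>n. coeff p k * x ^ k, \<Sum>k\<le>n. coeff q k * y ^ k) \<in> L"
    using p x by (intro sum mult power) (auto simp: poly_lim_def)
  moreover have "poly p x = (\<Sum>k\<le>n. coeff p k * x ^ k)"
    unfolding poly_altdef n_def by (intro sum.mono_neutral_left) (auto simp: coeff_eq_0 not_le)
  moreover have "poly q y = (\<Sum>k\<le>n. coeff q k * y ^ k)"
    unfolding poly_altdef n_def by (intro sum.mono_neutral_left) (auto simp: coeff_eq_0 not_le)
  ultimately show ?thesis by simp
qed

end

section \<open>Maximal limit algebras\<close>

locale maximal_limit_algebra = limit_algebra B L
  for B :: "'i filter" and L :: "(('i \<Rightarrow> 'f::alg_closed_field) \<times> 'f) set" +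
  assumes maximal: "limit_algebra B L' \<Longrightarrow> L \<subseteq> L' \<Longrightarrow> L' = L"
begin

text \<open>
  If \<open>x\<close> has no limit, no candidate \<open>z\<close> can be added consistently, because \<open>L\<close> is maximal. So
  for every \<open>z\<close> some polynomial relation of \<open>x\<close> over \<open>L\<close> has a limit polynomial that does not
  vanish at \<open>z\<close>. The limit polynomials of the relations of \<open>x\<close> form an ideal, which therefore is
  the unit ideal.
\<close>

lemma relation_of_divergent:
  assumes x: "\<nexists>y. (x, y) \<in> L"
  shows "\<exists>p. poly_lim p 1 \<and> (\<forall>\<^sub>F i in B. poly p x i = 0)"
proof -
  define J where "J = {q. \<exists>p. poly_lim p q \<and> (\<forall>\<^sub>F i in B. poly p x i = 0)}"
  have "1 \<in> J"
  proof (rule poly_ideal_without_common_root)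
    show "p + q \<in> J" if pq: "p \<in> J" "q \<in> J" for p q
    proof -
      obtain p' q' where "poly_lim p' p" "\<forall>\<^sub>F i in B. poly p' x i = 0"
        "poly_lim q' q" "\<forall>\<^sub>F i in B. poly q' x i = 0" using pq unfolding J_def by blast
      then show ?thesis unfolding J_def
        by (auto intro!: exI[of _ "p' + q'"] poly_lim_add elim: eventually_elim2)
    qed
    have mult_J: "r * q \<in> J" if q: "q \<in> J" and s: "poly_lim s r" for q r s
    proof -
      obtain p where "poly_lim p q" "\<forall>\<^sub>F i in B. poly p x i = 0" using q unfolding J_def by blast
      then show ?thesis unfolding J_def using s
        by (auto intro!: exI[of _ "s * p"] poly_lim_mult elim: eventually_mono)
    qed
    show "smult c q \<in> J" if "q \<in> J" for c q
      using mult_J[OF that poly_lim_const[OF const[of c]]] by simp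
    show "pCons 0 q \<in> J" if "q \<in> J" for q
      using mult_J[OF that poly_lim_var] by simp
    show "\<exists>q\<in>J. poly q z \<noteq> 0" for z
    proof (rule ccontr)
      assume z: "\<not> ?thesis"
      \<comment> \<open>The algebra generated by \<open>L\<close> and the pair \<open>(x, z)\<close>.\<close>
      define L' where "L' = {(poly p x, poly q z) |p q. poly_lim p q}"
      have I: "(poly p x, poly q z) \<in> L'" if "poly_lim p q" for p q
        using that by (auto simp: L'_def)
      have sub: "L \<subseteq> L'"
      proof (intro subrelI)
        fix u v assume "(u, v) \<in> L"
        then show "(u, v) \<in> L'" using I[OF poly_lim_const] by force
      qed
      have "limit_algebra B L'"
      proof
        show "(\<lambda>_. c, c) \<in> L'" for c using sub const by blast
        show "(u + u', v + v') \<in> L'" if "(u, v) \<in> L'" "(u', v') \<in> L'" for u v u' v'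
          using that I[OF poly_lim_add] unfolding L'_def by force
        show "(u * u', v * v') \<in> L'" if "(u, v) \<in> L'" "(u', v') \<in> L'" for u v u' v'
          using that I[OF poly_lim_mult] unfolding L'_def by force
        show "v = 0" if "(u, v) \<in> L'" "\<forall>\<^sub>F i in B. u i = 0" for u v
          using that z unfolding L'_def J_def by auto
      qed
      then have "L' = L" using maximal sub by blast
      then show False using I[OF poly_lim_var] x by auto
    qed
  qed
  then show ?thesis by (auto simp: J_def)
qed

text \<open>The large sets are the members of the ultrafilter that \<open>L\<close> determines.\<close>

definition large :: "'i set \<Rightarrow> bool" where
  "large S \<longleftrightarrow> (indicator S, 1) \<in> L"

text \<open>
  Where \<open>x\<close> vanishes, a relation of \<open>x\<close> with limit polynomial \<open>1\<close> reduces to its constant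
  coefficient, which tends to \<open>1\<close>; so on a large set there is no such relation.
\<close>

lemma vanish_on_large:
  assumes "large S" and "\<And>i. i \<in> S \<Longrightarrow> x i = 0"
  shows "(x, 0) \<in> L"
proof -
  have S: "(indicator S, 1) \<in> L" using assms(1) by (simp add: large_def)
  have "\<exists>y. (x, y) \<in> L"
  proof (rule ccontr)
    assume "\<not> ?thesis"
    then obtain p where p: "poly_lim p 1" "\<forall>\<^sub>F i in B. poly p x i = 0"
      using relation_of_divergent by blast
    have "(coeff p 0 * indicator S, 1 * 1) \<in> L"
      by (intro mult S poly_lim_1D p)
    moreover have "\<forall>\<^sub>F i in B. (coeff p 0 * indicator S) i = 0"
      using p(2) by eventually_elim (auto simp: indicator_def assms(2) fun_poly_apply_zero)
    ultimately show False using eventually_zero by fastforce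
  qed
  then obtain y where y: "(x, y) \<in> L" by blast
  have "x * indicator S = (\<lambda>_. 0)" using assms(2) by (auto simp: fun_eq_iff indicator_def)
  then have "y = 0" using eventually_zero[OF mult[OF y S]] by simp
  then show ?thesis using y by simp
qed

text \<open>
  An indicator function is idempotent, so its limit can only be \<open>0\<close> or \<open>1\<close>. It has one: by a
  relation \<open>p\<close> with limit polynomial \<open>1\<close>, the constant coefficient of \<open>p\<close> would vanish outside
  \<open>S\<close> and \<open>p(1)\<close> on \<open>S\<close>, although both tend to \<open>1\<close>.
\<close>

lemma large_or_compl: "large S \<or> large (- S)"
proof -
  have idem: "y = 0 \<or> y = 1" if "(indicator S, y) \<in> L" for y
  proof -
    have "(indicator S * indicator S :: 'i \<Rightarrow> 'f) = indicator S"
      by (auto simp: fun_eq_iff indicator_def)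
    then have "(indicator S, y * y) \<in> L" using mult[OF that that] by simp
    from unique[OF this that] have "y * y = y" by simp
    then show ?thesis by simp
  qed
  have "\<exists>y. (indicator S, y) \<in> L"
  proof (rule ccontr)
    assume "\<not> ?thesis"
    then obtain p where p: "poly_lim p 1" "\<forall>\<^sub>F i in B. poly p (indicator S) i = 0"
      using relation_of_divergent by blast
    have "(poly p (\<lambda>_. 1), 1) \<in> L" using poly_lim_eval[OF p(1) const[of 1]] by simp
    moreover have "(coeff p 0, 1) \<in> L" using p(1) by (simp add: poly_lim_1D)
    ultimately have *: "(coeff p 0 * poly p (\<lambda>_. 1), 1 * 1) \<in> L" by (intro mult)
    have "\<forall>\<^sub>F i in B. (coeff p 0 * poly p (\<lambda>_. 1)) i = 0"
      using p(2)
    proof eventually_elim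
      case (elim i)
      show ?case
      proof (cases "i \<in> S")
        case True
        then show ?thesis using elim fun_poly_apply_cong[of "indicator S" i "\<lambda>_. 1" p] by simp
      next
        case False
        then show ?thesis using elim fun_poly_apply_zero[of "indicator S" i p] by simp
      qed
    qed
    with * show False using eventually_zero by fastforce
  qed
  then obtain y where y: "(indicator S, y) \<in> L" by blast
  have "(\<lambda>_. 1) - (indicator S :: 'i \<Rightarrow> 'f) = indicator (- S)"
    by (auto simp: fun_eq_iff indicator_def)
  then have "(indicator (- S), 1 - y) \<in> L" using diff[OF const[of 1] y] by simp
  then show ?thesis using idem[OF y] y by (auto simp: large_def)
qed

lemma large_Int: "large S \<Longrightarrow> large T \<Longrightarrow> large (S \<inter> T)"
proof -
  assume "large S" "large T"
  then have "(indicator S * indicator T, 1 * 1) \<in> L" unfolding large_def by (rule mult)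
  moreover have "(indicator S * indicator T :: 'i \<Rightarrow> 'f) = indicator (S \<inter> T)"
    by (auto simp: fun_eq_iff indicator_def)
  ultimately show ?thesis by (simp add: large_def)
qed

lemma not_large_empty: "\<not> large {}"
  using eventually_zero[of "indicator {}" 1] by (auto simp: large_def)

lemma large_mono: "large S \<Longrightarrow> S \<subseteq> T \<Longrightarrow> large T"
proof -
  assume S: "large S" "S \<subseteq> T"
  then have "S \<inter> - T = {}" by blast
  then have "\<not> large (- T)" using large_Int[OF S(1), of "- T"] not_large_empty by auto
  then show ?thesis using large_or_compl[of T] by blast
qed

lemma large_eventually:
  assumes "\<forall>\<^sub>F i in B. i \<in> S"
  shows "large S"
proof (rule ccontr)
  assume "\<not> large S"
  then have "(indicator (- S), 1) \<in> L" using large_or_compl by (auto simp: large_def)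
  moreover have "\<forall>\<^sub>F i in B. (indicator (- S) i :: 'f) = 0"
    using assms by eventually_elim simp
  ultimately show False using eventually_zero by fastforce
qed

definition large_filter :: "'i filter" where
  "large_filter = Abs_filter (\<lambda>P. large {i. P i})"

lemma eventually_large_filter: "eventually P large_filter \<longleftrightarrow> large {i. P i}"
  unfolding large_filter_def
proof (rule eventually_Abs_filter, rule is_filter.intro)
  show "large {i. True}" by (rule large_eventually) simp
  show "large {i. P i \<and> Q i}" if "large {i. P i}" "large {i. Q i}" for P Q
    using large_Int[OF that] by (simp add: Collect_conj_eq)
  show "large {i. Q i}" if "\<forall>i. P i \<longrightarrow> Q i" "large {i. P i}" for P Q
    using large_mono[OF that(2), of "{i. Q i}"] that(1) by blast
qed

text \<open>Limits depend only on the germ along the ultrafilter of large sets, which is finer than \<open>B\<close>.\<close>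

lemma limit_cong:
  assumes "(x, y) \<in> L" "large {i. x i = x' i}"
  shows "(x', y) \<in> L"
proof -
  have "(x' - x, 0) \<in> L" using assms(2) by (rule vanish_on_large) simp
  from add[OF assms(1) this] show ?thesis by simp
qed

lemma limit_unique:
  assumes "(x, y) \<in> L" "(x', y') \<in> L" "large {i. x i = x' i}"
  shows "y = y'"
  by (rule unique[OF limit_cong[OF assms(1,3)] assms(2)]) simp

lemma large_nonzero:
  assumes "(x, y) \<in> L" "y \<noteq> 0"
  shows "large {i. x i \<noteq> 0}"
proof (rule ccontr)
  assume "\<not> ?thesis"
  then have "large {i. x i = 0}"
    using large_or_compl[of "{i. x i \<noteq> 0}"] by (simp add: Collect_neg_eq [symmetric])
  then show False using limit_unique[OF assms(1) const[of 0]] assms(2) by simp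
qed

text \<open>
  The functions with a limit form a local ring. If \<open>1/x\<close> had no limit, multiplying its relation of
  degree \<open>n\<close> by \<open>x\<^sup>n\<close> would yield \<open>y\<^sup>n = 0\<close> in the limit.
\<close>

lemma limit_inverse:
  assumes xy: "(x, y) \<in> L" and y: "y \<noteq> 0"
  shows "(\<lambda>i. inverse (x i), inverse y) \<in> L"
proof -
  have nz: "large {i. x i \<noteq> 0}" by (rule large_nonzero[OF assms])
  have "\<exists>z. (\<lambda>i. inverse (x i), z) \<in> L"
  proof (rule ccontr)
    assume "\<not> ?thesis"
    then obtain p where p: "poly_lim p 1" "\<forall>\<^sub>F i in B. poly p (\<lambda>i. inverse (x i)) i = 0"
      using relation_of_divergent by blast
    define n where "n = degree p"
    define w where "w = (\<Sum>k\<le>n. coeff p k * x ^ (n - k))"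
    have "(w, \<Sum>k\<le>n. coeff 1 k * y ^ (n - k)) \<in> L"
      unfolding w_def using p(1) by (intro sum mult power xy) (auto simp: poly_lim_def)
    moreover have "(\<Sum>k\<le>n. coeff 1 k * y ^ (n - k)) = (\<Sum>k\<in>{0}. y ^ (n - k))"
      by (rule sum.mono_neutral_cong_right) auto
    ultimately have w: "(w, y ^ n) \<in> L" by simp
    have "large ({i. x i \<noteq> 0} \<inter> {i. poly p (\<lambda>i. inverse (x i)) i = 0})"
      using p(2) by (intro large_Int nz large_eventually) simp
    moreover have "w i = 0" if "x i \<noteq> 0" "poly p (\<lambda>i. inverse (x i)) i = 0" for i
    proof -
      have "w i = (\<Sum>k\<le>n. x i ^ n * (coeff p k i * inverse (x i) ^ k))"
        unfolding w_def fun_sum_apply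
        by (intro sum.cong) (auto simp: fun_power_apply that(1) power_diff field_simps)
      also have "\<dots> = x i ^ n * poly p (\<lambda>i. inverse (x i)) i"
        by (simp add: fun_poly_apply n_def sum_distrib_left)
      finally show ?thesis using that by simp
    qed
    ultimately have "large {i. w i = (\<lambda>_. 0) i}" by (elim large_mono) auto
    from limit_unique[OF w const this] show False using y by simp
  qed
  then obtain z where z: "(\<lambda>i. inverse (x i), z) \<in> L" by blast
  have "large {i. (x * (\<lambda>i. inverse (x i))) i = (\<lambda>_. 1) i}"
    by (rule large_mono[OF nz]) auto
  from limit_unique[OF mult[OF xy z] const this] have "z = inverse y"
    by (simp add: inverse_unique)
  then show ?thesis using z by simp
qed

text \<open>
  The germ of \<open>1\<close> is a polynomial of degree at most \<open>n\<close> in \<open>x\<close> with infinitesimal coefficients: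
  the maximal ideal of the ring of functions with a limit generates the unit ideal after adjoining
  \<open>x\<close>.
\<close>

definition small_relation :: "('i \<Rightarrow> 'f) \<Rightarrow> nat \<Rightarrow> bool" where
  "small_relation x n \<longleftrightarrow>
     (\<exists>a. (\<forall>k. (a k, 0) \<in> L) \<and> large {i. (\<Sum>k\<le>n. a k i * x i ^ k) = 1})"

lemma small_relation_of_divergent:
  assumes "\<nexists>y. (x, y) \<in> L"
  shows "\<exists>n. small_relation x n"
proof -
  obtain p where p: "poly_lim p 1" "\<forall>\<^sub>F i in B. poly p x i = 0"
    using relation_of_divergent[OF assms] by blast
  have one: "coeff (1 :: ('i \<Rightarrow> 'f) poly) k = (\<lambda>_. coeff 1 k)" for k
    by (simp add: fun_eq_iff)
  have "(coeff 1 k - coeff p k, 0) \<in> L" for k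
  proof -
    have "(coeff 1 k - coeff p k, coeff 1 k - coeff 1 k) \<in> L"
      unfolding one using p(1) by (intro diff const) (auto simp: poly_lim_def)
    then show ?thesis by simp
  qed
  moreover have "large {i. (\<Sum>k\<le>degree p. (coeff 1 k - coeff p k) i * x i ^ k) = 1}"
  proof (rule large_eventually)
    show "\<forall>\<^sub>F i in B. i \<in> {i. (\<Sum>k\<le>degree p. (coeff 1 k - coeff p k) i * x i ^ k) = 1}"
      using p(2)
    proof eventually_elim
      case (elim i)
      have "(\<Sum>k\<le>degree p. (coeff 1 k - coeff p k) i * x i ^ k) =
          (\<Sum>k\<le>degree p. coeff 1 k * x i ^ k) - poly p x i"
        by (simp add: fun_poly_apply left_diff_distrib sum_subtractf fun_of_bool_apply)
      also have "(\<Sum>k\<le>degree p. coeff 1 k * x i ^ k) = (\<Sum>k\<in>{0}. x i ^ k)"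
        by (rule sum.mono_neutral_cong_right) auto
      finally have eq: "(\<Sum>k\<le>degree p. (coeff 1 k - coeff p k) i * x i ^ k) =
        (\<Sum>k\<in>{0}. x i ^ k) - poly p x i" .
      show ?case unfolding mem_Collect_eq eq elim by simp
    qed
  qed
  ultimately have "small_relation x (degree p)" unfolding small_relation_def
    by (intro exI[of _ "\<lambda>k. coeff 1 k - coeff p k"] conjI allI)
  then show ?thesis by blast
qed

lemma small_relation_mono:
  assumes "small_relation x n" "n \<le> m"
  shows "small_relation x m"
proof -
  obtain a where a: "\<And>k. (a k, 0) \<in> L" "large {i. (\<Sum>k\<le>n. a k i * x i ^ k) = 1}"
    using assms(1) by (auto simp: small_relation_def)
  define a' where "a' k = (if k \<le> n then a k else (\<lambda>_. 0))" for k
  have "(\<Sum>k\<le>m. a' k i * x i ^ k) = (\<Sum>k\<le>n. a k i * x i ^ k)" for i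
    using assms(2) by (intro sum.mono_neutral_cong_right) (auto simp: a'_def)
  then show ?thesis unfolding small_relation_def
    using a const[of 0] by (intro exI[of _ a']) (auto simp: a'_def)
qed

text \<open>
  The classical step in the extension theorem for places: solve the relation of \<open>1/x\<close> for the top
  power of \<open>x\<close> and substitute it into the relation of \<open>x\<close>. The factor \<open>1 - b\<^sub>0\<close> that has to be
  inverted tends to \<open>1\<close>.
\<close>

lemma small_relation_step:
  assumes x: "small_relation x (Suc n)" and x': "small_relation (\<lambda>i. inverse (x i)) (Suc n)"
    and nz: "large {i. x i \<noteq> 0}"
  shows "small_relation x n"
proof -
  obtain a where a: "\<And>k. (a k, 0) \<in> L" "large {i. (\<Sum>k\<le>Suc n. a k i * x i ^ k) = 1}"
    using x by (auto simp: small_relation_def)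
  obtain b where b: "\<And>k. (b k, 0) \<in> L"
    "large {i. (\<Sum>k\<le>Suc n. b k i * inverse (x i) ^ k) = 1}"
    using x' by (auto simp: small_relation_def)
  define c where "c = (\<lambda>_. 1) - b 0"
  have c: "(c, 1) \<in> L" unfolding c_def using diff[OF const[of 1] b(1)[of 0]] by simp
  define c' where "c' = (\<lambda>i. inverse (c i))"
  have c': "(c', 1) \<in> L" using limit_inverse[OF c] by (simp add: c'_def)
  define a' where "a' k = a k + a (Suc n) * c' * b (Suc n - k)" for k
  have "(a' k, 0 + 0 * 1 * 0) \<in> L" for k
    unfolding a'_def by (intro add mult a b c')
  moreover have "(\<Sum>k\<le>n. a' k i * x i ^ k) = 1"
    if "x i \<noteq> 0" "c i \<noteq> 0" and A: "(\<Sum>k\<le>Suc n. a k i * x i ^ k) = 1"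
      and B: "(\<Sum>k\<le>Suc n. b k i * inverse (x i) ^ k) = 1" for i
  proof -
    have "c i = (\<Sum>k\<le>n. b (Suc k) i * inverse (x i) ^ Suc k)"
      using B unfolding sum.atMost_Suc_shift by (simp add: c_def algebra_simps)
    then have "c i * x i ^ Suc n = (\<Sum>k\<le>n. b (Suc k) i * inverse (x i) ^ Suc k * x i ^ Suc n)"
      by (simp add: sum_distrib_right)
    also have "\<dots> = (\<Sum>k\<le>n. b (Suc k) i * x i ^ (n - k))"
      using that(1) by (intro sum.cong) (auto simp: power_diff field_simps)
    also have "\<dots> = (\<Sum>k\<le>n. b (Suc n - k) i * x i ^ k)"
      by (rule sum.reindex_bij_witness[of _ "\<lambda>k. n - k" "\<lambda>k. n - k"]) (auto simp: Suc_diff_le)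
    finally have "x i ^ Suc n = c' i * (\<Sum>k\<le>n. b (Suc n - k) i * x i ^ k)"
      using that(2) by (simp add: c'_def field_simps)
    then have "(\<Sum>k\<le>Suc n. a k i * x i ^ k) =
        (\<Sum>k\<le>n. a k i * x i ^ k) + a (Suc n) i * (c' i * (\<Sum>k\<le>n. b (Suc n - k) i * x i ^ k))"
      by (simp only: sum.atMost_Suc)
    also have "\<dots> = (\<Sum>k\<le>n. a' k i * x i ^ k)"
      by (simp add: a'_def sum_distrib_left sum.distrib distrib_right mult.assoc)
    finally show ?thesis using A by simp
  qed
  then have "large {i. (\<Sum>k\<le>n. a' k i * x i ^ k) = 1}"
    by (intro large_mono[OF large_Int[OF large_Int[OF nz large_nonzero[OF c]]
      large_Int[OF a(2) b(2)]]]) auto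
  ultimately show ?thesis unfolding small_relation_def by auto
qed

text \<open>
  Relations of equal degree for \<open>x\<close> and \<open>1/x\<close> can be lowered together, by the symmetry of the
  previous lemma, down to degree \<open>0\<close>, where an infinitesimal function would have the germ of \<open>1\<close>.
\<close>

lemma no_two_small_relations:
  assumes "large {i. x i \<noteq> 0}" "small_relation x n" "small_relation (\<lambda>i. inverse (x i)) n"
  shows False
  using assms
proof (induction n)
  case 0
  from 0(2) obtain a where a: "(\<forall>k. (a k, 0) \<in> L) \<and> large {i. (\<Sum>k\<le>0. a k i * x i ^ k) = 1}"
    unfolding small_relation_def ..
  then have "(a 0, 0) \<in> L" "large {i. a 0 i = (\<lambda>_. 1) i}" by simp_all
  from limit_unique[OF this(1) const this(2)] show False by simp
next
  case (Suc n)
  have "small_relation x n" by (rule small_relation_step[OF Suc.prems(2,3,1)])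
  moreover have "small_relation (\<lambda>i. inverse (x i)) n"
    by (rule small_relation_step) (use Suc.prems in simp_all)
  ultimately show False using Suc by blast
qed

lemma limit_or_inverse_limit_zero: "(\<exists>y. (x, y) \<in> L) \<or> (\<lambda>i. inverse (x i), 0) \<in> L"
proof (rule ccontr)
  assume *: "\<not> ?thesis"
  have nz: "large {i. x i \<noteq> 0}"
  proof (rule ccontr)
    assume "\<not> ?thesis"
    then have "large {i. x i = 0}"
      using large_or_compl[of "{i. x i \<noteq> 0}"] by (simp add: Collect_neg_eq [symmetric])
    then have "(x, 0) \<in> L" by (rule vanish_on_large) simp
    then show False using * by blast
  qed
  have "\<nexists>z. (\<lambda>i. inverse (x i), z) \<in> L"
  proof safe
    fix z assume z: "(\<lambda>i. inverse (x i), z) \<in> L"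
    then have "(x, inverse z) \<in> L" using * limit_inverse[OF z] by fastforce
    then show False using * by blast
  qed
  then obtain n where "small_relation (\<lambda>i. inverse (x i)) n"
    using small_relation_of_divergent by blast
  moreover obtain m where "small_relation x m" using * small_relation_of_divergent by blast
  ultimately show False
    using no_two_small_relations[OF nz, of "max m n"]
      small_relation_mono[of x m "max m n"] small_relation_mono[of "\<lambda>i. inverse (x i)" n "max m n"]
    by simp
qed

end

section \<open>Ultralimits\<close>

text \<open>
  The germs of functions along \<open>U\<close> form a field, the functions with a limit a valuation ring in it,
  and the limit is the residue map. Since \<open>inverse 0 = 0\<close>, a function that vanishes almost
  everywhere falls under both alternatives of the dichotomy.
\<close>

locale ultralimit = limit_algebra U L for U :: "'i filter" and L :: "(('i \<Rightarrow> 'f::field) \<times> 'f) set" +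
  assumes ultra: "eventually P U \<or> (\<forall>\<^sub>F i in U. \<not> P i)"
    and cong: "(x, y) \<in> L \<Longrightarrow> \<forall>\<^sub>F i in U. x i = x' i \<Longrightarrow> (x', y) \<in> L"
    and limit_or_inverse_limit_zero: "(\<exists>y. (x, y) \<in> L) \<or> (\<lambda>i. inverse (x i), 0) \<in> L"

lemma (in maximal_limit_algebra) ultralimit_large_filter: "ultralimit large_filter L"
proof
  show "y = 0" if "(x, y) \<in> L" "\<forall>\<^sub>F i in large_filter. x i = 0" for x y
    using limit_unique[OF that(1) const[of 0]] that(2) by (simp add: eventually_large_filter)
  show "eventually P large_filter \<or> (\<forall>\<^sub>F i in large_filter. \<not> P i)" for P
    using large_or_compl[of "{i. P i}"] by (simp add: eventually_large_filter Collect_neg_eq)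
  show "(x', y) \<in> L" if "(x, y) \<in> L" "\<forall>\<^sub>F i in large_filter. x i = x' i" for x y x'
    using limit_cong that by (simp add: eventually_large_filter)
  show "(\<exists>y. (x, y) \<in> L) \<or> (\<lambda>i. inverse (x i), 0) \<in> L" for x
    by (rule limit_or_inverse_limit_zero)
qed (auto intro: const add mult)

text \<open>Chevalley's extension of places, for the ultrapowers of an algebraically closed field.\<close>

theorem ultralimit_extension:
  fixes L0 :: "(('i \<Rightarrow> 'f::alg_closed_field) \<times> 'f) set"
  assumes "limit_algebra B L0"
  obtains U L where "ultralimit U L" "L0 \<subseteq> L" "U \<le> B"
proof -
  define \<A> where "\<A> = {L. limit_algebra B L \<and> L0 \<subseteq> L}"
  have "\<exists>L\<in>\<A>. \<forall>X\<in>\<A>. L \<subseteq> X \<longrightarrow> X = L"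
  proof (rule subset_Zorn_nonempty)
    show "\<A> \<noteq> {}" using assms by (auto simp: \<A>_def)
    fix \<C> assume ne: "\<C> \<noteq> {}" and chain: "subset.chain \<A> \<C>"
    have C: "limit_algebra B X" "L0 \<subseteq> X" if "X \<in> \<C>" for X
      using chain that by (auto simp: subset.chain_def \<A>_def)
    have common: "\<exists>X\<in>\<C>. p \<in> X \<and> q \<in> X" if "p \<in> \<Union>\<C>" "q \<in> \<Union>\<C>" for p q
      using that chain unfolding subset.chain_def by blast
    have "limit_algebra B (\<Union>\<C>)"
    proof
      show "(\<lambda>_. c, c) \<in> \<Union>\<C>" for c using ne C limit_algebra.const by blast
      show "(x + x', y + y') \<in> \<Union>\<C>" if "(x, y) \<in> \<Union>\<C>" "(x', y') \<in> \<Union>\<C>" for x y x' y'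
        using common[OF that] C limit_algebra.add by blast
      show "(x * x', y * y') \<in> \<Union>\<C>" if "(x, y) \<in> \<Union>\<C>" "(x', y') \<in> \<Union>\<C>" for x y x' y'
        using common[OF that] C limit_algebra.mult by blast
      show "y = 0" if "(x, y) \<in> \<Union>\<C>" "\<forall>\<^sub>F i in B. x i = 0" for x y
        using that C limit_algebra.eventually_zero by blast
    qed
    then show "\<Union>\<C> \<in> \<A>" using ne C by (auto simp: \<A>_def)
  qed
  then obtain L where "L \<in> \<A>" and max: "\<forall>X\<in>\<A>. L \<subseteq> X \<longrightarrow> X = L" by (rule bexE)
  then have L: "limit_algebra B L" "L0 \<subseteq> L" by (auto simp: \<A>_def)
  have "maximal_limit_algebra_axioms B L"
  proof
    fix X assume X: "limit_algebra B X" "L \<subseteq> X"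
    then have "X \<in> \<A>" using L(2) by (auto simp: \<A>_def)
    then show "X = L" using max X(2) by simp
  qed
  with L(1) interpret maximal_limit_algebra B L
    by (rule maximal_limit_algebra.intro)
  have "large_filter \<le> B"
  proof (rule filter_leI)
    show "eventually P large_filter" if "eventually P B" for P
      unfolding eventually_large_filter by (rule large_eventually) (simp add: that)
  qed
  then show ?thesis by (rule that[OF ultralimit_large_filter L(2)])
qed

section \<open>Convergent bases of families of subspaces\<close>

interpretation seq: vector_space "seq_scale :: 'f::field \<Rightarrow> (nat \<Rightarrow> 'f) \<Rightarrow> nat \<Rightarrow> 'f"
  by (rule vector_space_seq_scale)

text \<open>
  The reduced echelon bases: the coordinates in \<open>I\<close> restrict to an isomorphism on \<open>W\<close>, and
  \<open>u\<close> is the basis of \<open>W\<close> dual to them. That \<open>u\<close> spans \<open>W\<close> is encoded by the expansion with the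
  coordinates in \<open>I\<close> as coefficients, an equation that can be checked entrywise in the limit.
\<close>

definition pivot_basis :: "nat set \<Rightarrow> (nat \<Rightarrow> nat \<Rightarrow> 'f::field) \<Rightarrow> (nat \<Rightarrow> 'f) set \<Rightarrow> bool" where
  "pivot_basis I u W \<longleftrightarrow> (\<forall>l\<in>I. u l \<in> W) \<and> (\<forall>l\<in>I. \<forall>m\<in>I. u l m = of_bool (l = m)) \<and>
     (\<forall>v\<in>W. v = (\<Sum>l\<in>I. seq_scale (v l) (u l)))"

lemma sum_scale_apply_pivot:
  assumes "finite I" "m \<in> I" "\<And>l. l \<in> I \<Longrightarrow> u l m = of_bool (l = m)"
  shows "(\<Sum>l\<in>I. seq_scale (c l) (u l)) m = (c m :: 'f::field)"
proof -
  have "(\<Sum>l\<in>I. seq_scale (c l) (u l)) m = (\<Sum>l\<in>I. if l = m then c l else 0)"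
    unfolding fun_sum_apply by (intro sum.cong) (auto simp: seq_scale_def assms(3))
  then show ?thesis using assms(1,2) by simp
qed

lemma pivot_inj: "(\<And>l m. l \<in> I \<Longrightarrow> m \<in> I \<Longrightarrow> u l m = (of_bool (l = m) :: 'f::field)) \<Longrightarrow> inj_on u I"
  by (rule inj_onI) (metis of_bool_eq(1,2) zero_neq_one)

lemma pivot_basis_dim:
  fixes W :: "(nat \<Rightarrow> 'f::field) set"
  assumes I: "finite I" and W: "seq.subspace W" and u: "pivot_basis I u W"
  shows "seq.dim W = card I"
proof -
  have piv: "\<And>l m. l \<in> I \<Longrightarrow> m \<in> I \<Longrightarrow> u l m = of_bool (l = m)" and mem: "u ` I \<subseteq> W"
    and rep: "\<And>v. v \<in> W \<Longrightarrow> v = (\<Sum>l\<in>I. seq_scale (v l) (u l))"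
    using u unfolding pivot_basis_def by blast+
  have inj: "inj_on u I" by (rule pivot_inj) (rule piv)
  have "seq.independent (u ` I)"
  proof (rule seq.independent_if_scalars_zero)
    show "finite (u ` I)" using I by simp
    fix f x assume f: "(\<Sum>x\<in>u ` I. seq_scale (f x) x) = 0" and "x \<in> u ` I"
    then obtain m where m: "m \<in> I" "x = u m" by blast
    have "f x = (\<Sum>l\<in>I. seq_scale (f (u l)) (u l)) m"
      using sum_scale_apply_pivot[OF I m(1), of u "\<lambda>l. f (u l)"] piv m by simp
    also have "\<dots> = 0" using f by (simp add: sum.reindex[OF inj])
    finally show "f x = 0" .
  qed
  moreover have "W \<subseteq> seq.span (u ` I)"
  proof
    fix v assume "v \<in> W"
    then have "v = (\<Sum>l\<in>I. seq_scale (v l) (u l))" by (rule rep)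
    also have "\<dots> \<in> seq.span (u ` I)"
      by (intro seq.span_sum seq.span_scale seq.span_base) simp
    finally show "v \<in> seq.span (u ` I)" .
  qed
  ultimately have "seq.dim W = card (u ` I)"
    using mem by (metis seq.basis_card_eq_dim)
  then show ?thesis by (simp add: card_image inj)
qed

lemma pivot_basis_span:
  fixes u :: "nat \<Rightarrow> nat \<Rightarrow> 'f::field"
  assumes I: "finite I" and piv: "\<And>l m. l \<in> I \<Longrightarrow> m \<in> I \<Longrightarrow> u l m = of_bool (l = m)"
  shows "pivot_basis I u (seq.span (u ` I))"
  unfolding pivot_basis_def
proof (intro conjI ballI piv)
  show "u l \<in> seq.span (u ` I)" if "l \<in> I" for l using that by (simp add: seq.span_base)
  fix v assume "v \<in> seq.span (u ` I)"
  then obtain c where c: "v = (\<Sum>x\<in>u ` I. seq_scale (c x) x)"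
    using seq.span_finite[of "u ` I"] I by auto
  have inj: "inj_on u I" by (rule pivot_inj) (rule piv)
  have v: "v = (\<Sum>l\<in>I. seq_scale (c (u l)) (u l))" unfolding c by (simp add: sum.reindex[OF inj])
  have "v m = c (u m)" if "m \<in> I" for m
    unfolding v by (rule sum_scale_apply_pivot[OF I that]) (rule piv[OF _ that])
  then show "v = (\<Sum>l\<in>I. seq_scale (v l) (u l))"
    by (subst v) (intro sum.cong, auto)
qed

context ultralimit
begin

lemma nontrivial: "U \<noteq> bot"
  using eventually_zero[OF const[of 1]] by (auto simp: trivial_limit_def)

text \<open>
  By the dichotomy, \<open>v\<^sub>k / v\<^sub>l\<close> or its inverse has a limit; this is a total preorder on the
  coordinates that do not vanish almost everywhere, and a finite set has a largest element.
\<close>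

lemma dominant_coordinate:
  assumes D: "finite D" and ev: "\<forall>\<^sub>F i in U. \<exists>k\<in>D. v i k \<noteq> 0"
  shows "\<exists>k0\<in>D. (\<forall>\<^sub>F i in U. v i k0 \<noteq> 0) \<and> (\<forall>k\<in>D. \<exists>y. (\<lambda>i. v i k / v i k0, y) \<in> L)"
proof -
  define E where "E = {k\<in>D. \<forall>\<^sub>F i in U. v i k \<noteq> 0}"
  have zero: "\<forall>\<^sub>F i in U. v i k = 0" if "k \<in> D - E" for k
    using that ultra[of "\<lambda>i. v i k \<noteq> 0"] by (auto simp: E_def)
  have fin: "finite E" using D by (simp add: E_def)
  have "E \<noteq> {}"
  proof
    assume "E = {}"
    then have "\<forall>\<^sub>F i in U. \<forall>k\<in>D. v i k = 0"
      using zero D by (intro eventually_ball_finite) auto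
    with ev have "\<forall>\<^sub>F i in U. False" by eventually_elim auto
    then show False using nontrivial by (simp add: trivial_limit_def)
  qed
  have "\<exists>k0\<in>F. \<forall>k\<in>F. \<exists>y. (\<lambda>i. v i k / v i k0, y) \<in> L" if "finite F" "F \<noteq> {}" "F \<subseteq> E" for F
    using that
  proof (induction F rule: finite_ne_induct)
    case (singleton x)
    then have "\<forall>\<^sub>F i in U. v i x \<noteq> 0" by (simp add: E_def)
    then have "\<forall>\<^sub>F i in U. 1 = v i x / v i x" by eventually_elim simp
    from cong[OF const this] show ?case by auto
  next
    case (insert x F)
    then obtain k0 where k0: "k0 \<in> F" "\<And>k. k \<in> F \<Longrightarrow> \<exists>y. (\<lambda>i. v i k / v i k0, y) \<in> L" by auto
    have nz: "\<forall>\<^sub>F i in U. v i x \<noteq> 0" "\<forall>\<^sub>F i in U. v i k0 \<noteq> 0"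
      using insert.prems k0(1) by (auto simp: E_def)
    from limit_or_inverse_limit_zero[of "\<lambda>i. v i x / v i k0"]
    show ?case
    proof
      assume "\<exists>y. (\<lambda>i. v i x / v i k0, y) \<in> L"
      then show ?thesis using k0 by (intro bexI[of _ k0]) auto
    next
      assume "(\<lambda>i. inverse (v i x / v i k0), 0) \<in> L"
      then have *: "(\<lambda>i. v i k0 / v i x, 0) \<in> L" by simp
      have "\<exists>y. (\<lambda>i. v i k / v i x, y) \<in> L" if k: "k \<in> insert x F" for k
      proof (cases "k = x")
        case True
        have "\<forall>\<^sub>F i in U. 1 = v i x / v i x" using nz(1) by eventually_elim simp
        from cong[OF const this] show ?thesis using True by auto
      next
        case False
        then obtain y where y: "(\<lambda>i. v i k / v i k0, y) \<in> L" using k0(2)[of k] k by blast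
        have "\<forall>\<^sub>F i in U. ((\<lambda>i. v i k / v i k0) * (\<lambda>i. v i k0 / v i x)) i = v i k / v i x"
          using nz by eventually_elim simp
        from cong[OF mult[OF y *] this] show ?thesis by blast
      qed
      then show ?thesis by blast
    qed
  qed
  from this[OF fin \<open>E \<noteq> {}\<close>] obtain k0 where k0: "k0 \<in> E"
    "\<And>k. k \<in> E \<Longrightarrow> \<exists>y. (\<lambda>i. v i k / v i k0, y) \<in> L" by auto
  have "\<exists>y. (\<lambda>i. v i k / v i k0, y) \<in> L" if "k \<in> D - E" for k
  proof -
    have "\<forall>\<^sub>F i in U. 0 = v i k / v i k0" using zero[OF that] by eventually_elim simp
    from cong[OF const this] show ?thesis by blast
  qed
  then show ?thesis using k0 by (auto simp: E_def)
qed

text \<open>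
  Compactness of Grassmannians, by Gaussian elimination. A nonzero vector of \<open>W i\<close>, scaled so that
  its dominant coordinate \<open>p\<close> is \<open>1\<close>, has convergent entries. The vectors of \<open>W i\<close> with
  vanishing coordinate \<open>p\<close> involve fewer coordinates, so induction applies to them; finally their
  basis is used to clear the other pivot entries of the scaled vector.
\<close>

lemma convergent_pivot_basis:
  assumes "finite D"
    and "\<And>i. seq.subspace (W i)"
    and "\<And>i w k. w \<in> W i \<Longrightarrow> k \<notin> D \<Longrightarrow> w k = 0"
  shows "\<exists>I u. I \<subseteq> D \<and> (\<forall>\<^sub>F i in U. pivot_basis I (u i) (W i)) \<and>
    (\<forall>l\<in>I. \<forall>k. \<exists>y. (\<lambda>i. u i l k, y) \<in> L)"
  using assms
proof (induction D arbitrary: W rule: finite_remove_induct)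
  case empty
  then have "w = 0" if "w \<in> W i" for i w using that by (auto simp: fun_eq_iff)
  then have "pivot_basis {} (u i) (W i)" for u i by (auto simp: pivot_basis_def)
  then show ?case by auto
next
  case (remove D)
  note sub = remove.prems(1) and supp = remove.prems(2)
  show ?case
  proof (cases "\<forall>\<^sub>F i in U. W i \<subseteq> {0}")
    case True
    then have "\<forall>\<^sub>F i in U. pivot_basis {} (u i) (W i)" for u
      by eventually_elim (auto simp: pivot_basis_def)
    then show ?thesis by auto
  next
    case False
    then have ne: "\<forall>\<^sub>F i in U. \<not> W i \<subseteq> {0}" using ultra by blast
    define v where "v i = (SOME w. w \<in> W i \<and> w \<noteq> 0)" for i
    have v: "\<forall>\<^sub>F i in U. v i \<in> W i \<and> v i \<noteq> 0"
      using ne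
    proof eventually_elim
      case (elim i)
      then have "\<exists>w. w \<in> W i \<and> w \<noteq> 0" by blast
      then show ?case unfolding v_def by (rule someI_ex)
    qed
    have "\<forall>\<^sub>F i in U. \<exists>k\<in>D. v i k \<noteq> 0"
      using v
    proof eventually_elim
      case (elim i)
      then obtain k where "v i k \<noteq> 0" by (auto simp: fun_eq_iff)
      then show ?case using supp[of "v i" i k] elim by blast
    qed
    from dominant_coordinate[OF remove.hyps(1) this] obtain p where p: "p \<in> D"
      "\<forall>\<^sub>F i in U. v i p \<noteq> 0" and lim: "\<And>k. k \<in> D \<Longrightarrow> \<exists>y. (\<lambda>i. v i k / v i p, y) \<in> L"
      by blast
    define w where "w i = seq_scale (inverse (v i p)) (v i)" for i
    have w: "\<forall>\<^sub>F i in U. w i \<in> W i \<and> w i p = 1"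
      using v p(2)
    proof eventually_elim
      case (elim i)
      then have "w i \<in> W i" unfolding w_def by (intro seq.subspace_scale[OF sub]) simp
      moreover have "w i p = 1" using elim by (simp add: w_def seq_scale_def)
      ultimately show ?case ..
    qed
    have w_lim: "\<exists>y. (\<lambda>i. w i k, y) \<in> L" for k
    proof (cases "k \<in> D")
      case True
      then show ?thesis using lim by (simp add: w_def seq_scale_def field_simps)
    next
      case False
      have "\<forall>\<^sub>F i in U. 0 = w i k" using w by eventually_elim (use supp False in auto)
      from cong[OF const this] show ?thesis by blast
    qed
    define W' where "W' i = {x \<in> W i. x p = 0}" for i
    have sub': "seq.subspace (W' i)" for i
      unfolding W'_def
      by (rule seq.subspaceI)
        (simp_all add: seq.subspace_0[OF sub] seq.subspace_add[OF sub] seq.subspace_scale[OF sub],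
         simp add: seq_scale_def)
    have "\<exists>I u. I \<subseteq> D - {p} \<and> (\<forall>\<^sub>F i in U. pivot_basis I (u i) (W' i)) \<and>
        (\<forall>l\<in>I. \<forall>k. \<exists>y. (\<lambda>i. u i l k, y) \<in> L)"
      by (rule remove.IH[OF p(1) sub']) (auto simp: W'_def supp)
    then obtain I u where I: "I \<subseteq> D - {p}" and u: "\<forall>\<^sub>F i in U. pivot_basis I (u i) (W' i)"
      and u_lim: "\<And>l k. l \<in> I \<Longrightarrow> \<exists>y. (\<lambda>i. u i l k, y) \<in> L" by blast
    have fI: "finite I" using I remove.hyps(1) by (meson finite_Diff finite_subset)
    have pI: "p \<notin> I" using I by blast
    define z where "z i = w i - (\<Sum>l\<in>I. seq_scale (w i l) (u i l))" for i
    define u' where "u' i = (u i)(p := z i)" for i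
    have "\<forall>\<^sub>F i in U. pivot_basis (insert p I) (u' i) (W i)"
      using u w
    proof eventually_elim
      case (elim i)
      have mem: "u i l \<in> W i" "u i l p = 0" if "l \<in> I" for l
        using elim(1) that by (auto simp: pivot_basis_def W'_def)
      have piv: "u i l m = of_bool (l = m)" if "l \<in> I" "m \<in> I" for l m
        using elim(1) that by (auto simp: pivot_basis_def)
      have sum_p: "(\<Sum>l\<in>I. seq_scale (c l) (u i l)) p = 0" for c
        unfolding fun_sum_apply by (simp add: seq_scale_def mem)
      have sum_I: "(\<Sum>l\<in>I. seq_scale (c l) (u i l)) m = c m" if "m \<in> I" for c m
        by (rule sum_scale_apply_pivot[OF fI that]) (rule piv[OF _ that])
      have zW: "z i \<in> W i" unfolding z_def using elim(2) mem(1)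
        by (intro seq.subspace_diff[OF sub] seq.subspace_sum[OF sub] seq.subspace_scale[OF sub]) auto
      have zp: "z i p = 1" using elim(2) sum_p by (simp add: z_def)
      have zI: "z i m = 0" if "m \<in> I" for m using sum_I[OF that] by (simp add: z_def)
      have "x = (\<Sum>l\<in>insert p I. seq_scale (x l) (u' i l))" if x: "x \<in> W i" for x
      proof -
        define x' where "x' = x - seq_scale (x p) (z i)"
        have "x' \<in> W' i"
        proof -
          have "x' \<in> W i" unfolding x'_def
            by (intro seq.subspace_diff[OF sub] seq.subspace_scale[OF sub] x zW)
          moreover have "x' p = 0" by (simp add: x'_def seq_scale_def zp)
          ultimately show ?thesis by (simp add: W'_def)
        qed
        then have "x' = (\<Sum>l\<in>I. seq_scale (x' l) (u i l))"
          using elim(1) unfolding pivot_basis_def by blast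
        also have "\<dots> = (\<Sum>l\<in>I. seq_scale (x l) (u' i l))"
          using pI by (intro sum.cong) (auto simp: x'_def u'_def zI seq_scale_def)
        finally have "x - seq_scale (x p) (z i) = (\<Sum>l\<in>I. seq_scale (x l) (u' i l))"
          by (simp add: x'_def)
        then show ?thesis using fI pI by (simp add: u'_def diff_eq_eq add.commute)
      qed
      then show ?case unfolding pivot_basis_def
        using mem piv zW zp zI pI by (auto simp: u'_def)
    qed
    moreover have "\<exists>y. (\<lambda>i. u' i l k, y) \<in> L" if l: "l \<in> insert p I" for l k
    proof (cases "l = p")
      case True
      define y where "y k = (SOME y. (\<lambda>i. w i k, y) \<in> L)" for k
      have y: "(\<lambda>i. w i k, y k) \<in> L" for k unfolding y_def by (rule someI_ex[OF w_lim])
      define y' where "y' l k = (SOME y. (\<lambda>i. u i l k, y) \<in> L)" for l k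
      have y': "(\<lambda>i. u i l k, y' l k) \<in> L" if "l \<in> I" for l k
        unfolding y'_def by (rule someI_ex[OF u_lim[OF that]])
      have "((\<lambda>i. w i k) - (\<Sum>l\<in>I. (\<lambda>i. w i l) * (\<lambda>i. u i l k)), y k - (\<Sum>l\<in>I. y l * y' l k)) \<in> L"
        by (intro diff sum mult y y' fI)
      moreover have "(\<lambda>i. w i k) - (\<Sum>l\<in>I. (\<lambda>i. w i l) * (\<lambda>i. u i l k)) = (\<lambda>i. u' i l k)"
        using True by (simp add: fun_eq_iff fun_sum_apply u'_def z_def seq_scale_def)
      ultimately show ?thesis by auto
    next
      case False
      then show ?thesis using u_lim l by (auto simp: u'_def)
    qed
    ultimately show ?thesis using I p(1) by (intro exI[of _ "insert p I"] exI[of _ u']) auto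
  qed
qed

end

section \<open>Representations given by matrices\<close>

definition coordinate_space :: "nat \<Rightarrow> (nat \<Rightarrow> 'f::field) set" where
  "coordinate_space m = {v. \<forall>n\<ge>m. v n = 0}"

definition unit_vector :: "nat \<Rightarrow> nat \<Rightarrow> 'f::field" where
  "unit_vector l n = of_bool (l = n)"

lemma subspace_coordinate_space: "seq.subspace (coordinate_space m)"
  by (rule seq.subspaceI) (auto simp: coordinate_space_def seq_scale_def)

lemma pivot_basis_coordinate_space: "pivot_basis {..<m} unit_vector (coordinate_space m)"
  unfolding pivot_basis_def
proof (intro conjI ballI)
  fix v :: "nat \<Rightarrow> 'f::field" assume v: "v \<in> coordinate_space m"
  show "v = (\<Sum>l<m. seq_scale (v l) (unit_vector l))"
  proof
    fix n
    show "v n = (\<Sum>l<m. seq_scale (v l) (unit_vector l)) n"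
    proof (cases "n < m")
      case True
      then show ?thesis by (subst sum_scale_apply_pivot) (auto simp: unit_vector_def)
    next
      case False
      then show ?thesis using v
        by (simp add: fun_sum_apply seq_scale_def unit_vector_def coordinate_space_def)
    qed
  qed
qed (auto simp: unit_vector_def coordinate_space_def)

lemma dim_coordinate_space: "seq.dim (coordinate_space m) = m"
  using pivot_basis_dim[OF _ subspace_coordinate_space pivot_basis_coordinate_space] by simp

lemma coordinate_space_expand:
  "v \<in> coordinate_space m \<Longrightarrow> (\<Sum>l<m. seq_scale (v l) (unit_vector l)) = v"
  using pivot_basis_coordinate_space[of m] unfolding pivot_basis_def by metis

lemma coordinate_space_span: "coordinate_space m \<subseteq> seq.span (unit_vector ` {..<m})"
proof
  fix v :: "nat \<Rightarrow> 'f::field" assume "v \<in> coordinate_space m"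
  then have "v = (\<Sum>l<m. seq_scale (v l) (unit_vector l))" by (simp only: coordinate_space_expand)
  also have "\<dots> \<in> seq.span (unit_vector ` {..<m})"
    by (intro seq.span_sum seq.span_scale seq.span_base) simp
  finally show "v \<in> seq.span (unit_vector ` {..<m})" .
qed

text \<open>
  The row index \<open>n\<close> is cut off at \<open>d (head Q a)\<close> so that all matrices, whatever their entries
  outside the relevant block, give maps into the coordinate space at the head.
\<close>

definition matrix_rep ::
  "('v, 'a) pre_digraph \<Rightarrow> ('v \<Rightarrow> nat) \<Rightarrow> ('a \<Rightarrow> nat \<Rightarrow> nat \<Rightarrow> 'f::field) \<Rightarrow> ('v, 'a, nat \<Rightarrow> 'f) quiver_rep"
where
  "matrix_rep Q d M = \<lparr>rep_space = (\<lambda>i. coordinate_space (d i)),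
     rep_map = (\<lambda>a v n. if n < d (head Q a) then \<Sum>m<d (tail Q a). M a n m * v m else 0)\<rparr>"

lemma rep_space_matrix_rep [simp]: "rep_space (matrix_rep Q d M) i = coordinate_space (d i)"
  by (simp add: matrix_rep_def)

lemma rep_map_matrix_rep:
  "rep_map (matrix_rep Q d M) a v n =
    (if n < d (head Q a) then \<Sum>m<d (tail Q a). M a n m * v m else 0)"
  by (simp add: matrix_rep_def)

lemma linear_matrix_rep: "Vector_Spaces.linear seq_scale seq_scale (rep_map (matrix_rep Q d M) a)"
  by (auto intro!: Vector_Spaces.linear_iff[THEN iffD2] conjI vector_space_seq_scale
    simp: fun_eq_iff rep_map_matrix_rep seq_scale_def distrib_left sum.distrib sum_distrib_left ac_simps)

lemma matrix_rep_representation: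
  fixes M :: "'a \<Rightarrow> nat \<Rightarrow> nat \<Rightarrow> 'f::field"
  shows "quiver_representation seq_scale Q (matrix_rep Q d M)"
proof -
  have "linear_on seq_scale S (rep_map (matrix_rep Q d M) a)" for S a
    using linear_matrix_rep[of Q d M a] by (auto simp: linear_on_def Vector_Spaces.linear_iff)
  moreover have "rep_map (matrix_rep Q d M) a ` S \<subseteq> coordinate_space (d (head Q a))" for S a
    by (auto simp: coordinate_space_def rep_map_matrix_rep)
  moreover have "\<exists>B. finite B \<and> coordinate_space m \<subseteq> seq.span (B :: (nat \<Rightarrow> 'f) set)" for m
    using coordinate_space_span[of m] by blast
  ultimately show ?thesis
    by (simp add: quiver_representation_def subspace_coordinate_space)
qed

lemma dimvec_matrix_rep:
  "dimension_vector Q d \<Longrightarrow> dimvec seq_scale Q (rep_space (matrix_rep Q d M)) = d"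
  by (auto simp: dimvec_def dim_coordinate_space dimension_vector_def fun_eq_iff)

lemma linear_on_sum:
  assumes "linear_on seq_scale S f" "seq.subspace S" "finite A" "\<And>j. j \<in> A \<Longrightarrow> x j \<in> S"
  shows "f (\<Sum>j\<in>A. seq_scale (c j) (x j)) = (\<Sum>j\<in>A. seq_scale (c j) (f (x j)))"
  using assms(3,4)
proof (induction A rule: finite_induct)
  case empty
  have "f (seq_scale 0 0) = seq_scale 0 (f 0)"
    using assms(1) seq.subspace_0[OF assms(2)] unfolding linear_on_def by blast
  then have "f 0 = 0" by simp
  then show ?case by (simp only: sum.empty)
next
  case (insert j A)
  have "(\<Sum>j\<in>A. seq_scale (c j) (x j)) \<in> S" "seq_scale (c j) (x j) \<in> S" "x j \<in> S"
    using insert by (auto intro!: seq.subspace_sum[OF assms(2)] seq.subspace_scale[OF assms(2)])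
  then have "f (seq_scale (c j) (x j) + (\<Sum>j\<in>A. seq_scale (c j) (x j))) =
      f (seq_scale (c j) (x j)) + f (\<Sum>j\<in>A. seq_scale (c j) (x j))"
    "f (seq_scale (c j) (x j)) = seq_scale (c j) (f (x j))"
    using assms(1) unfolding linear_on_def by blast+
  moreover have "f (\<Sum>j\<in>A. seq_scale (c j) (x j)) = (\<Sum>j\<in>A. seq_scale (c j) (f (x j)))"
    using insert by blast
  ultimately show ?case by (simp only: sum.insert[OF insert.hyps])
qed

text \<open>Choosing bases puts all representations of dimension vector \<open>d\<close> on the same spaces.\<close>

lemma matrix_rep_exists:
  fixes V :: "('v, 'a, nat \<Rightarrow> 'f::field) quiver_rep"
  assumes Q: "wf_digraph Q" and V: "quiver_representation seq_scale Q V"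
    and d: "dimvec seq_scale Q (rep_space V) = d"
  shows "\<exists>M h. rep_iso seq_scale seq_scale Q (matrix_rep Q d M) V h"
proof -
  interpret wf_digraph Q by fact
  interpret pair: vector_space_pair "seq_scale :: 'f \<Rightarrow> _" "seq_scale :: 'f \<Rightarrow> _" by unfold_locales
  have VS: "seq.subspace (rep_space V i)" "\<exists>B. finite B \<and> rep_space V i \<subseteq> seq.span B"
    if "i \<in> verts Q" for i
    using V that by (auto simp: quiver_representation_def)
  have "\<exists>h. Vector_Spaces.linear seq_scale seq_scale h \<and>
      h ` coordinate_space (d i) = rep_space V i \<and> inj_on h (coordinate_space (d i))"
    if i: "i \<in> verts Q" for i
  proof -
    obtain C where C: "C \<subseteq> rep_space V i" "seq.independent C" "rep_space V i \<subseteq> seq.span C"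
      "card C = seq.dim (rep_space V i)"
      by (rule seq.basis_exists)
    obtain D :: "(nat \<Rightarrow> 'f) set" where D: "D \<subseteq> coordinate_space (d i)" "seq.independent D"
      "coordinate_space (d i) \<subseteq> seq.span D" "card D = seq.dim (coordinate_space (d i) :: (nat \<Rightarrow> 'f) set)"
      by (rule seq.basis_exists[of "coordinate_space (d i) :: (nat \<Rightarrow> 'f) set"])
    have fC: "finite C"
      using VS(2)[OF i] seq.independent_span_bound[OF _ C(2)] C(1) by (meson order_trans)
    have fD: "finite D"
      using seq.independent_span_bound[OF _ D(2), of "unit_vector ` {..<d i}"]
        coordinate_space_span[of "d i"] D(1) by (meson finite_imageI finite_lessThan order_trans)
    have "seq.dim (coordinate_space (d i) :: (nat \<Rightarrow> 'f) set) = seq.dim (rep_space V i)"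
      using d i by (auto simp: dim_coordinate_space dimvec_def)
    then show ?thesis
      using pair.finite_basis_to_basis_subspace_isomorphism[OF subspace_coordinate_space VS(1)[OF i]
          _ fD D fC C] by metis
  qed
  then obtain h where lin: "\<And>i. i \<in> verts Q \<Longrightarrow> Vector_Spaces.linear seq_scale seq_scale (h i)"
    and img: "\<And>i. i \<in> verts Q \<Longrightarrow> h i ` coordinate_space (d i) = rep_space V i"
    and inj: "\<And>i. i \<in> verts Q \<Longrightarrow> inj_on (h i) (coordinate_space (d i))"
    by metis
  define c where "c a m = inv_into (coordinate_space (d (head Q a))) (h (head Q a))
    (rep_map V a (h (tail Q a) (unit_vector m)))" for a m
  define M where "M a n m = c a m n" for a n m
  have "rep_map V a (h (tail Q a) x) = h (head Q a) (rep_map (matrix_rep Q d M) a x)"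
    if a: "a \<in> arcs Q" and x: "x \<in> coordinate_space (d (tail Q a))" for a x
  proof -
    let ?t = "tail Q a" and ?h = "head Q a"
    have th: "?t \<in> verts Q" "?h \<in> verts Q" using a by auto
    interpret t: Vector_Spaces.linear seq_scale seq_scale "h ?t" by (rule lin[OF th(1)])
    interpret hd: Vector_Spaces.linear seq_scale seq_scale "h ?h" by (rule lin[OF th(2)])
    have Va: "linear_on seq_scale (rep_space V ?t) (rep_map V a)"
      "rep_map V a ` rep_space V ?t \<subseteq> rep_space V ?h"
      using V a by (auto simp: quiver_representation_def)
    have e: "h ?t (unit_vector m) \<in> rep_space V ?t" if "m < d ?t" for m
      using img[OF th(1)] that pivot_basis_coordinate_space[of "d ?t"]
      by (auto simp: pivot_basis_def)
    have c: "c a m \<in> coordinate_space (d ?h)" "h ?h (c a m) = rep_map V a (h ?t (unit_vector m))"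
      if "m < d ?t" for m
    proof -
      have "rep_map V a (h ?t (unit_vector m)) \<in> h ?h ` coordinate_space (d ?h)"
        using e[OF that] Va(2) img[OF th(2)] by blast
      then show "c a m \<in> coordinate_space (d ?h)" "h ?h (c a m) = rep_map V a (h ?t (unit_vector m))"
        unfolding c_def by (rule inv_into_into, rule f_inv_into_f)
    qed
    have "rep_map V a (h ?t x) = rep_map V a (\<Sum>m<d ?t. seq_scale (x m) (h ?t (unit_vector m)))"
      by (subst coordinate_space_expand[OF x, symmetric]) (simp add: t.sum t.scale)
    also have "\<dots> = (\<Sum>m<d ?t. seq_scale (x m) (rep_map V a (h ?t (unit_vector m))))"
      by (rule linear_on_sum[OF Va(1) VS(1)[OF th(1)]]) (auto simp: e)
    also have "\<dots> = h ?h (\<Sum>m<d ?t. seq_scale (x m) (c a m))"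
      by (simp add: hd.sum hd.scale c)
    also have "(\<Sum>m<d ?t. seq_scale (x m) (c a m)) = rep_map (matrix_rep Q d M) a x"
    proof
      fix n
      have "c a m n = 0" if "m < d ?t" "\<not> n < d ?h" for m
        using c(1)[OF that(1)] that(2) by (simp add: coordinate_space_def)
      then show "(\<Sum>m<d ?t. seq_scale (x m) (c a m)) n = rep_map (matrix_rep Q d M) a x n"
        by (simp add: fun_sum_apply rep_map_matrix_rep M_def seq_scale_def mult.commute)
    qed
    finally show ?thesis .
  qed
  then have "rep_iso seq_scale seq_scale Q (matrix_rep Q d M) V h"
    using lin img inj by (simp add: rep_iso_def)
  then show ?thesis by blast
qed

section \<open>Specialization of subrepresentations\<close>

definition has_subrep ::
  "('v, 'a) pre_digraph \<Rightarrow> ('v \<Rightarrow> nat) \<Rightarrow> ('v, 'a, nat \<Rightarrow> 'f::field) quiver_rep \<Rightarrow> bool" where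
  "has_subrep Q e V \<longleftrightarrow> (\<exists>U. subrepresentation seq_scale Q V U \<and> dimvec seq_scale Q U = e)"

text \<open>
  The initial limits are the values of polynomials at \<open>s\<^sub>0\<close>. They are consistent along the filter
  of cofinite subsets of \<open>T\<close>, because only the zero polynomial vanishes at infinitely many points.
\<close>

lemma limit_algebra_specialization:
  assumes "infinite T"
  shows "limit_algebra (inf cofinite (principal T)) {(poly p, poly p s0 :: 'f::field) |p. True}"
proof
  let ?L = "{(poly p, poly p s0) |p. True}"
  show "(\<lambda>_. c, c) \<in> ?L" for c
    by (rule CollectI, rule exI[of _ "[:c:]"]) (simp add: fun_eq_iff)
  show "(x + x', y + y') \<in> ?L" if xy: "(x, y) \<in> ?L" "(x', y') \<in> ?L" for x y x' y'
  proof -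
    obtain p q where "x = poly p" "y = poly p s0" "x' = poly q" "y' = poly q s0" using xy by blast
    then show ?thesis by (intro CollectI exI[of _ "p + q"]) (simp add: fun_eq_iff)
  qed
  show "(x * x', y * y') \<in> ?L" if xy: "(x, y) \<in> ?L" "(x', y') \<in> ?L" for x y x' y'
  proof -
    obtain p q where "x = poly p" "y = poly p s0" "x' = poly q" "y' = poly q s0" using xy by blast
    then show ?thesis by (intro CollectI exI[of _ "p * q"]) (simp add: fun_eq_iff)
  qed
  fix x y assume xy: "(x, y) \<in> ?L" and ev: "\<forall>\<^sub>F s in inf cofinite (principal T). x s = 0"
  obtain p where p: "x = poly p" "y = poly p s0" using xy by blast
  have "p = 0"
  proof (rule ccontr)
    assume "p \<noteq> 0"
    then have "finite {s. poly p s = 0}" by (rule poly_roots_finite)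
    moreover have "finite {s. \<not> (s \<in> T \<longrightarrow> poly p s = 0)}"
      using ev by (simp add: eventually_inf_principal eventually_cofinite p)
    ultimately have "finite ({s. poly p s = 0} \<union> {s. \<not> (s \<in> T \<longrightarrow> poly p s = 0)})" by simp
    then have "finite T" by (rule rev_finite_subset) auto
    then show False using assms by simp
  qed
  then show "y = 0" by (simp add: p)
qed

text \<open>
  Choose a subrepresentation \<open>S s\<close> for each good \<open>s\<close> and convergent pivot bases \<open>u j s\<close> of its
  spaces; the limits \<open>ub j\<close> of these bases span a subrepresentation of \<open>V s\<^sub>0\<close>. For an arrow
  \<open>a\<close>, the image of a basis vector at the tail is expanded in the basis at the head with its own
  pivot coordinates as coefficients, and both sides of this equation have limits.
\<close>

theorem has_subrep_specialization:
  fixes P :: "'a \<Rightarrow> nat \<Rightarrow> nat \<Rightarrow> 'f::alg_closed_field poly" and Q :: "('v, 'a) pre_digraph"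
    and d :: "'v \<Rightarrow> nat"
  defines "V \<equiv> \<lambda>s. matrix_rep Q d (\<lambda>a n m. poly (P a n m) s)"
  assumes Q: "wf_digraph Q" and inf: "infinite {s. has_subrep Q e (V s)}"
  shows "has_subrep Q e (V s0)"
proof -
  interpret wf_digraph Q by fact
  define T where "T = {s. has_subrep Q e (V s)}"
  obtain U L where UL: "ultralimit U L" "{(poly p, poly p s0) |p. True} \<subseteq> L"
    "U \<le> inf cofinite (principal T)"
    using ultralimit_extension[OF limit_algebra_specialization[of T s0]] inf
    unfolding T_def by blast
  interpret ultralimit U L by fact
  have poly_lim: "(\<lambda>s. poly p s, poly p s0) \<in> L" for p using UL(2) by auto
  have ev_T: "\<forall>\<^sub>F s in U. s \<in> T"
    using filter_leD[OF UL(3)] by (simp add: eventually_inf_principal)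
  define S where "S s = (SOME U. subrepresentation seq_scale Q (V s) U \<and> dimvec seq_scale Q U = e)" for s
  have S: "subrepresentation seq_scale Q (V s) (S s) \<and> dimvec seq_scale Q (S s) = e" if "s \<in> T" for s
  proof -
    have "\<exists>U. subrepresentation seq_scale Q (V s) U \<and> dimvec seq_scale Q U = e"
      using that by (simp add: T_def has_subrep_def)
    from someI_ex[OF this] show ?thesis by (simp only: S_def)
  qed
  \<comment> \<open>The value \<open>{0}\<close> off \<open>T\<close> is a default; \<open>T\<close> belongs to the ultrafilter.\<close>
  define W where "W j s = (if s \<in> T \<and> j \<in> verts Q then S s j else {0})" for j s
  have W_sub: "seq.subspace (W j s)" for j s
    using S[of s] by (simp add: W_def subrepresentation_def)
  have W_supp: "w k = 0" if "w \<in> W j s" "k \<notin> {..<d j}" for w j s k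
  proof (cases "s \<in> T \<and> j \<in> verts Q")
    case True
    then have "S s j \<subseteq> coordinate_space (d j)"
      using S[of s] by (simp add: subrepresentation_def V_def)
    then have "w \<in> coordinate_space (d j)" using that(1) True by (auto simp: W_def)
    then show ?thesis using that(2) by (simp add: coordinate_space_def)
  next
    case False
    then have "w = 0" using that(1) by (auto simp: W_def)
    then show ?thesis by simp
  qed
  have "\<forall>j. \<exists>Iu. fst Iu \<subseteq> {..<d j} \<and> (\<forall>\<^sub>F s in U. pivot_basis (fst Iu) (snd Iu s) (W j s)) \<and>
      (\<forall>l\<in>fst Iu. \<forall>k. \<exists>y. (\<lambda>s. snd Iu s l k, y) \<in> L)"
  proof
    fix j
    have "\<exists>I u. I \<subseteq> {..<d j} \<and> (\<forall>\<^sub>F s in U. pivot_basis I (u s) (W j s)) \<and>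
        (\<forall>l\<in>I. \<forall>k. \<exists>y. (\<lambda>s. u s l k, y) \<in> L)"
      by (rule convergent_pivot_basis) (rule finite_lessThan, rule W_sub, rule W_supp)
    then obtain I u where "I \<subseteq> {..<d j}" "\<forall>\<^sub>F s in U. pivot_basis I (u s) (W j s)"
      "\<forall>l\<in>I. \<forall>k. \<exists>y. (\<lambda>s. u s l k, y) \<in> L" by (elim exE conjE)
    then show "\<exists>Iu. fst Iu \<subseteq> {..<d j} \<and> (\<forall>\<^sub>F s in U. pivot_basis (fst Iu) (snd Iu s) (W j s)) \<and>
        (\<forall>l\<in>fst Iu. \<forall>k. \<exists>y. (\<lambda>s. snd Iu s l k, y) \<in> L)"
      by (intro exI[of _ "(I, u)"]) simp
  qed
  from choice[OF this] obtain Iu where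
    Iu': "\<forall>j. fst (Iu j) \<subseteq> {..<d j} \<and> (\<forall>\<^sub>F s in U. pivot_basis (fst (Iu j)) (snd (Iu j) s) (W j s)) \<and>
      (\<forall>l\<in>fst (Iu j). \<forall>k. \<exists>y. (\<lambda>s. snd (Iu j) s l k, y) \<in> L)" ..
  define I where "I j = fst (Iu j)" for j
  define u where "u j = snd (Iu j)" for j
  have Iu: "I j \<subseteq> {..<d j} \<and> (\<forall>\<^sub>F s in U. pivot_basis (I j) (u j s) (W j s)) \<and>
      (\<forall>l\<in>I j. \<forall>k. \<exists>y. (\<lambda>s. u j s l k, y) \<in> L)" for j
    using Iu' by (simp add: I_def u_def)
  have fI: "finite (I j)" for j using Iu[of j] by (meson finite_lessThan finite_subset)
  have basis: "\<forall>\<^sub>F s in U. pivot_basis (I j) (u j s) (W j s)" for j using Iu by blast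
  define ub where "ub j l k = (SOME y. (\<lambda>s. u j s l k, y) \<in> L)" for j l k
  have ub: "(\<lambda>s. u j s l k, ub j l k) \<in> L" if "l \<in> I j" for j l k
    unfolding ub_def by (rule someI_ex) (use Iu that in blast)
  have piv: "ub j l m = of_bool (l = m)" if "l \<in> I j" "m \<in> I j" for j l m
  proof (rule unique[OF ub[OF that(1)] const])
    show "\<forall>\<^sub>F s in U. u j s l m = of_bool (l = m)"
      using basis[of j] by eventually_elim (use that in \<open>simp add: pivot_basis_def\<close>)
  qed
  define N where "N j = seq.span (ub j ` I j)" for j
  have N_coord: "N j \<subseteq> coordinate_space (d j)" for j
    unfolding N_def
  proof (rule seq.span_minimal[OF _ subspace_coordinate_space], clarify)
    fix l assume l: "l \<in> I j"
    have "ub j l k = 0" if k: "k \<ge> d j" for k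
    proof (rule eventually_zero[OF ub[OF l]])
      show "\<forall>\<^sub>F s in U. u j s l k = 0"
        using basis[of j]
      proof eventually_elim
        case (elim s)
        then show ?case using l W_supp[of "u j s l" j s k] k by (simp add: pivot_basis_def)
      qed
    qed
    then show "ub j l \<in> coordinate_space (d j)" by (simp add: coordinate_space_def)
  qed
  have arrow: "rep_map (V s0) a ` N (tail Q a) \<subseteq> N (head Q a)" if a: "a \<in> arcs Q" for a
  proof -
    let ?t = "tail Q a" and ?h = "head Q a"
    have th: "?t \<in> verts Q" "?h \<in> verts Q" using a by auto
    interpret f: Vector_Spaces.linear seq_scale seq_scale "rep_map (V s0) a"
      unfolding V_def by (rule linear_matrix_rep)
    have "rep_map (V s0) a (ub ?t l) \<in> N ?h" if l: "l \<in> I ?t" for l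
    proof -
      define x where "x s = rep_map (V s) a (u ?t s l)" for s
      define y where "y = rep_map (V s0) a (ub ?t l)"
      have lim: "(\<lambda>s. x s n, y n) \<in> L" for n
      proof (cases "n < d ?h")
        case True
        have "(\<Sum>m<d ?t. (\<lambda>s. poly (P a n m) s) * (\<lambda>s. u ?t s l m),
            \<Sum>m<d ?t. poly (P a n m) s0 * ub ?t l m) \<in> L"
          by (intro sum mult poly_lim ub l finite_lessThan)
        moreover have "(\<Sum>m<d ?t. (\<lambda>s. poly (P a n m) s) * (\<lambda>s. u ?t s l m)) = (\<lambda>s. x s n)"
          using True by (simp add: fun_eq_iff fun_sum_apply x_def V_def rep_map_matrix_rep)
        ultimately show ?thesis using True by (simp add: y_def V_def rep_map_matrix_rep)
      next
        case False
        then show ?thesis using const[of 0] by (simp add: x_def y_def V_def rep_map_matrix_rep)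
      qed
      have "y n = (\<Sum>l'\<in>I ?h. seq_scale (y l') (ub ?h l')) n" for n
      proof (rule unique[OF lim])
        have "(\<Sum>l'\<in>I ?h. (\<lambda>s. x s l') * (\<lambda>s. u ?h s l' n), \<Sum>l'\<in>I ?h. y l' * ub ?h l' n) \<in> L"
          by (intro sum mult lim ub fI)
        then show "(\<Sum>l'\<in>I ?h. (\<lambda>s. x s l') * (\<lambda>s. u ?h s l' n),
            (\<Sum>l'\<in>I ?h. seq_scale (y l') (ub ?h l')) n) \<in> L"
          by (simp add: fun_sum_apply seq_scale_def)
        show "\<forall>\<^sub>F s in U. x s n = (\<Sum>l'\<in>I ?h. (\<lambda>s. x s l') * (\<lambda>s. u ?h s l' n)) s"
          using basis[of ?t] basis[of ?h] ev_T
        proof eventually_elim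
          case (elim s)
          have "u ?t s l \<in> W ?t s" using elim(1) l by (simp add: pivot_basis_def)
          then have "u ?t s l \<in> S s ?t" using elim(3) th by (simp add: W_def)
          moreover have "rep_map (V s) a ` S s ?t \<subseteq> S s ?h"
            using S[OF elim(3)] a by (simp add: subrepresentation_def)
          ultimately have "x s \<in> W ?h s" using elim(3) th by (auto simp: x_def W_def)
          then have "x s = (\<Sum>l'\<in>I ?h. seq_scale (x s l') (u ?h s l'))"
            using elim(2) unfolding pivot_basis_def by blast
          then have "x s n = (\<Sum>l'\<in>I ?h. seq_scale (x s l') (u ?h s l')) n" by (rule fun_cong)
          then show ?case by (simp add: fun_sum_apply seq_scale_def)
        qed
      qed
      then have "y = (\<Sum>l'\<in>I ?h. seq_scale (y l') (ub ?h l'))" by (rule ext)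
      also have "\<dots> \<in> N ?h" unfolding N_def
        by (intro seq.span_sum seq.span_scale seq.span_base) simp
      finally show ?thesis by (simp add: y_def)
    qed
    then have "rep_map (V s0) a ` ub ?t ` I ?t \<subseteq> N ?h" by blast
    then have "seq.span (rep_map (V s0) a ` ub ?t ` I ?t) \<subseteq> N ?h"
      unfolding N_def by (rule seq.span_minimal[OF _ seq.subspace_span])
    then show ?thesis unfolding N_def by (simp add: f.span_image)
  qed
  have "subrepresentation seq_scale Q (V s0) N"
    using N_coord arrow by (auto simp: subrepresentation_def V_def N_def seq.subspace_span)
  moreover have "dimvec seq_scale Q N = e"
  proof
    fix j
    show "dimvec seq_scale Q N j = e j"
    proof (cases "j \<in> verts Q")
      case True
      have "\<exists>s. pivot_basis (I j) (u j s) (W j s) \<and> s \<in> T"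
        using eventually_happens[OF eventually_conj[OF basis[of j] ev_T]] nontrivial by simp
      then obtain s where s: "pivot_basis (I j) (u j s) (W j s)" "s \<in> T" by blast
      have "e j = seq.dim (S s j)" using S[OF s(2)] True by (auto simp: dimvec_def)
      also have "\<dots> = card (I j)"
        using pivot_basis_dim[OF fI W_sub s(1)] s(2) True by (simp add: W_def)
      also have "\<dots> = seq.dim (N j)" unfolding N_def
        by (rule pivot_basis_dim[symmetric, OF fI seq.subspace_span pivot_basis_span[OF fI piv]])
      finally show ?thesis using True by (simp add: dimvec_def)
    next
      case False
      obtain s where "s \<in> T" using eventually_happens[OF ev_T] nontrivial by blast
      then show ?thesis using S[of s] False by (auto simp: dimvec_def)
    qed
  qed
  ultimately show ?thesis unfolding has_subrep_def by blast
qed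

section \<open>General representations and expanders\<close>

text \<open>
  The ambient space is infinite-dimensional, so monotonicity of the dimension needs the finite
  spanning set \<open>B\<close>.
\<close>

lemma dim_subspace_le:
  assumes "finite B" "S \<subseteq> seq.span B" "seq.subspace R" "R \<subseteq> S"
  shows "seq.dim R \<le> seq.dim S" and "R \<noteq> {0} \<Longrightarrow> seq.dim R \<noteq> 0"
proof -
  obtain A where A: "A \<subseteq> R" "seq.independent A" "R \<subseteq> seq.span A" "card A = seq.dim R"
    by (rule seq.basis_exists[of R])
  obtain C where C: "C \<subseteq> S" "seq.independent C" "S \<subseteq> seq.span C" "card C = seq.dim S"
    by (rule seq.basis_exists[of S])
  have fC: "finite C" using seq.independent_span_bound[OF assms(1) C(2)] C(1) assms(2) by auto
  have fA: "finite A \<and> card A \<le> card C"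
    by (rule seq.independent_span_bound[OF fC A(2)]) (use A(1) assms(4) C(3) in blast)
  then show "seq.dim R \<le> seq.dim S" using A(4) C(4) by simp
  show "seq.dim R \<noteq> 0" if "R \<noteq> {0}"
  proof
    assume "seq.dim R = 0"
    then have "A = {}" using fA A(4) by simp
    then have "R \<subseteq> {0}" using A(3) by simp
    then show False using that seq.subspace_0[OF assms(3)] by blast
  qed
qed

lemma dimvec_subrepresentation_le:
  assumes V: "quiver_representation seq_scale Q V" and U: "subrepresentation seq_scale Q V U"
  shows "dimvec seq_scale Q U \<le> dimvec seq_scale Q (rep_space V)"
    and "i \<in> verts Q \<Longrightarrow> U i \<noteq> {0} \<Longrightarrow> dimvec seq_scale Q U \<noteq> 0"
proof -
  have *: "seq.subspace (U i)" "U i \<subseteq> rep_space V i"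
    "\<exists>B. finite B \<and> rep_space V i \<subseteq> seq.span B" if "i \<in> verts Q" for i
    using V U that by (auto simp: quiver_representation_def subrepresentation_def)
  show "dimvec seq_scale Q U \<le> dimvec seq_scale Q (rep_space V)"
    unfolding le_fun_def dimvec_def using * dim_subspace_le(1) by fastforce
  assume i: "i \<in> verts Q" "U i \<noteq> {0}"
  then have "seq.dim (U i) \<noteq> 0" using *[OF i(1)] dim_subspace_le(2) by blast
  then show "dimvec seq_scale Q U \<noteq> 0"
    using i(1) by (auto simp: dimvec_def fun_eq_iff intro!: exI[of _ i])
qed

lemma not_embeds_matrix_rep:
  assumes Q: "wf_digraph Q" and e: "e \<le> d" "\<not> embeds TYPE('f::field) Q e d"
  shows "\<exists>M :: 'a \<Rightarrow> nat \<Rightarrow> nat \<Rightarrow> 'f. \<not> has_subrep Q e (matrix_rep (Q :: ('v, 'a) pre_digraph) d M)"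
proof -
  obtain V :: "('v, 'a, nat \<Rightarrow> 'f) quiver_rep" where V: "quiver_representation seq_scale Q V"
    "dimvec seq_scale Q (rep_space V) = d" "\<not> has_subrep Q e V"
    using e by (auto simp: embeds_def has_subrep_def)
  obtain M h where h: "rep_iso seq_scale seq_scale Q (matrix_rep Q d M) V h"
    using matrix_rep_exists[OF Q V(1,2)] by blast
  have "\<not> has_subrep Q e (matrix_rep Q d M)"
    using push_subrepresentation[OF Q h] V(3) unfolding has_subrep_def by blast
  then show ?thesis by blast
qed

text \<open>
  On the line through \<open>M0\<close>, which avoids \<open>E\<close>, and \<open>M1\<close>, which avoids \<open>e\<close>, each dimension
  vector in \<open>insert e E\<close> is avoided at \<open>s = 0\<close> or at \<open>s = 1\<close>, hence by the specialization
  theorem at all but finitely many points.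
\<close>

lemma matrix_rep_avoiding:
  fixes Q :: "('v, 'a) pre_digraph" and E :: "('v \<Rightarrow> nat) set"
  assumes Q: "wf_digraph Q" and "finite E"
    and "\<And>e. e \<in> E \<Longrightarrow> \<exists>M :: 'a \<Rightarrow> nat \<Rightarrow> nat \<Rightarrow> 'f::alg_closed_field. \<not> has_subrep Q e (matrix_rep Q d M)"
  shows "\<exists>M :: 'a \<Rightarrow> nat \<Rightarrow> nat \<Rightarrow> 'f. \<forall>e\<in>E. \<not> has_subrep Q e (matrix_rep Q d M)"
  using assms(2,3)
proof (induction E rule: finite_induct)
  case (insert e E)
  obtain M0 :: "'a \<Rightarrow> nat \<Rightarrow> nat \<Rightarrow> 'f" where M0: "\<And>e. e \<in> E \<Longrightarrow> \<not> has_subrep Q e (matrix_rep Q d M0)"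
    using insert by blast
  obtain M1 :: "'a \<Rightarrow> nat \<Rightarrow> nat \<Rightarrow> 'f" where M1: "\<not> has_subrep Q e (matrix_rep Q d M1)"
    using insert.prems by blast
  define P where "P a n m = [:M0 a n m, M1 a n m - M0 a n m:]" for a n m
  define V where "V s = matrix_rep Q d (\<lambda>a n m. poly (P a n m) s)" for s
  have V01: "V 0 = matrix_rep Q d M0" "V 1 = matrix_rep Q d M1"
    by (simp_all add: V_def P_def)
  have "finite {s. has_subrep Q e' (V s)}" if "e' \<in> insert e E" for e'
  proof (rule ccontr)
    assume "infinite {s. has_subrep Q e' (V s)}"
    then have "has_subrep Q e' (V s0)" for s0
      using has_subrep_specialization[OF Q, of e' d P s0] unfolding V_def by blast
    then show False using that M0 M1 V01 by (metis insertE)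
  qed
  then have "finite (\<Union>e'\<in>insert e E. {s. has_subrep Q e' (V s)})"
    using insert.hyps(1) by blast
  then obtain s where "s \<notin> (\<Union>e'\<in>insert e E. {s. has_subrep Q e' (V s)})"
    using ex_new_if_finite[OF infinite_UNIV_alg_closed_field] by blast
  then show ?case unfolding V_def by blast
qed simp

lemma finite_dimension_vectors_le:
  fixes Q :: "('v, 'a) pre_digraph" and d :: "'v \<Rightarrow> nat"
  assumes "finite (verts Q)" "dimension_vector Q d"
  shows "finite {e. e \<le> d}"
proof (rule finite_subset)
  let ?F = "{e :: 'v \<Rightarrow> nat. \<forall>i. (i \<in> verts Q \<longrightarrow> e i \<in> {..Max (d ` verts Q)}) \<and> (i \<notin> verts Q \<longrightarrow> e i = 0)}"
  show "{e. e \<le> d} \<subseteq> ?F"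
  proof
    fix e assume "e \<in> {e. e \<le> d}"
    then have e: "e i \<le> d i" for i by (simp add: le_fun_def)
    have "e i \<in> {..Max (d ` verts Q)}" if "i \<in> verts Q" for i
    proof -
      note e
      also have "d i \<le> Max (d ` verts Q)" using assms(1) that by simp
      finally show ?thesis by simp
    qed
    moreover have "e i = 0" if "i \<notin> verts Q" for i
      using e[of i] assms(2) that by (simp add: dimension_vector_def)
    ultimately show "e \<in> ?F" by simp
  qed
  show "finite ?F" by (rule finite_set_of_finite_funs) (use assms(1) in simp_all)
qed

text \<open>
  A general representation of dimension vector \<open>d\<close>: the dimension vectors of its subrepresentations
  are those that occur in every representation of dimension vector \<open>d\<close>.
\<close>

theorem general_representation_exists:
  fixes Q :: "('v, 'a) pre_digraph"
  assumes "fin_digraph Q" and d: "dimension_vector Q d"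
  shows "\<exists>V :: ('v, 'a, nat \<Rightarrow> 'f::alg_closed_field) quiver_rep.
    quiver_representation seq_scale Q V \<and> dimvec seq_scale Q (rep_space V) = d \<and>
    (\<forall>U. subrepresentation seq_scale Q V U \<longrightarrow> embeds TYPE('f) Q (dimvec seq_scale Q U) d)"
proof -
  interpret fin_digraph Q by fact
  define E where "E = {e. e \<le> d \<and> \<not> embeds TYPE('f) Q e d}"
  have "finite E"
    by (rule finite_subset[OF _ finite_dimension_vectors_le[OF finite_verts d]]) (auto simp: E_def)
  then obtain M :: "'a \<Rightarrow> nat \<Rightarrow> nat \<Rightarrow> 'f"
    where M: "\<And>e. e \<in> E \<Longrightarrow> \<not> has_subrep Q e (matrix_rep Q d M)"
    using matrix_rep_avoiding[OF wf_digraph_axioms \<open>finite E\<close>] not_embeds_matrix_rep[OF wf_digraph_axioms]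
    unfolding E_def by (metis (no_types, lifting) mem_Collect_eq)
  have V: "quiver_representation seq_scale Q (matrix_rep Q d M)"
    "dimvec seq_scale Q (rep_space (matrix_rep Q d M)) = d"
    by (rule matrix_rep_representation, rule dimvec_matrix_rep[OF d])
  have "embeds TYPE('f) Q (dimvec seq_scale Q U) d"
    if U: "subrepresentation seq_scale Q (matrix_rep Q d M) U" for U
  proof (rule ccontr)
    assume "\<not> ?thesis"
    then have "dimvec seq_scale Q U \<in> E"
      using dimvec_subrepresentation_le(1)[OF V(1) U] V(2) by (simp add: E_def)
    then show False using M U unfolding has_subrep_def by blast
  qed
  then show ?thesis using V by blast
qed

theorem lemma3p2:
  fixes Q :: "('v, 'a) pre_digraph"
    and \<Theta> \<kappa> :: "'v \<Rightarrow> real"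
    and d :: "'v \<Rightarrow> nat"
    and \<delta> \<epsilon> :: real
  assumes "acyclic_quiver Q"
    and "\<forall>i\<in>verts Q. \<kappa> i > 0"
    and "dimension_vector Q d"
    and "0 < \<delta>" "\<delta> < 1" "\<epsilon> > 0"
  shows "(\<exists>V :: ('v, 'a, nat \<Rightarrow> 'f::alg_closed_field) quiver_rep.
            expander seq_scale Q \<Theta> \<kappa> \<delta> \<epsilon> V \<and> dimvec seq_scale Q (rep_space V) = d) \<longleftrightarrow>
         (\<forall>e. dimension_vector Q e \<and> e \<noteq> 0 \<and> embeds TYPE('f) Q e d \<and>
            functional Q \<kappa> e \<le> \<delta> * functional Q \<kappa> d \<longrightarrow>
            slope Q \<Theta> \<kappa> e \<le> slope Q \<Theta> \<kappa> d - \<epsilon>)"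
    (is "(\<exists>V. ?expander V) \<longleftrightarrow> ?generic")
proof
  assume "\<exists>V. ?expander V"
  then obtain V :: "('v, 'a, nat \<Rightarrow> 'f) quiver_rep"
    where V: "expander seq_scale Q \<Theta> \<kappa> \<delta> \<epsilon> V" "dimvec seq_scale Q (rep_space V) = d" by blast
  show ?generic
  proof (intro allI impI, elim conjE)
    fix e assume e: "e \<noteq> 0" "embeds TYPE('f) Q e d" "functional Q \<kappa> e \<le> \<delta> * functional Q \<kappa> d"
    obtain U where U: "subrepresentation seq_scale Q V U" "dimvec seq_scale Q U = e"
      using e(2) V unfolding embeds_def expander_def by blast
    obtain i where "e i \<noteq> 0" using e(1) by (auto simp: fun_eq_iff)
    then have i: "i \<in> verts Q" "seq.dim (U i) \<noteq> 0" using U(2) by (auto simp: dimvec_def split: if_splits)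
    have "seq.dim ({0} :: (nat \<Rightarrow> 'f) set) = 0"
      using pivot_basis_dim[of "{}" "{0} :: (nat \<Rightarrow> 'f) set"] by (simp add: pivot_basis_def)
    then have "U i \<noteq> {0}" using i(2) by auto
    then have "\<exists>i\<in>verts Q. U i \<noteq> {0}" using i(1) by (rule bexI)
    then show "slope Q \<Theta> \<kappa> e \<le> slope Q \<Theta> \<kappa> d - \<epsilon>"
      using V(1)[unfolded expander_def, THEN conjunct2, rule_format, of U] U e(3) V(2) by simp
  qed
next
  assume gen: ?generic
  obtain V :: "('v, 'a, nat \<Rightarrow> 'f) quiver_rep" where V: "quiver_representation seq_scale Q V"
    "dimvec seq_scale Q (rep_space V) = d"
    and emb: "\<And>U. subrepresentation seq_scale Q V U \<Longrightarrow> embeds TYPE('f) Q (dimvec seq_scale Q U) d"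
    using general_representation_exists[of Q d] assms(1,3) unfolding acyclic_quiver_def by blast
  have "slope Q \<Theta> \<kappa> (dimvec seq_scale Q U) \<le> slope Q \<Theta> \<kappa> d - \<epsilon>"
    if U: "subrepresentation seq_scale Q V U" "i \<in> verts Q" "U i \<noteq> {0}"
      "functional Q \<kappa> (dimvec seq_scale Q U) \<le> \<delta> * functional Q \<kappa> d" for U i
  proof -
    have "dimension_vector Q (dimvec seq_scale Q U)" by (simp add: dimension_vector_def dimvec_def)
    then show ?thesis
      using gen emb[OF U(1)] dimvec_subrepresentation_le(2)[OF V(1) U(1-3)] U(4) by blast
  qed
  then have "expander seq_scale Q \<Theta> \<kappa> \<delta> \<epsilon> V"
    using V unfolding expander_def by blast
  then show "\<exists>V. ?expander V" using V(2) by blast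
qed

end
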